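(* Consider the delayed online convex optimization setting described in the context, with a non-empty, closed, convex domain $\mathcal{X}\subseteq\mathbb{R}^n$ containing $\mathbf{0}$ and with $\max_{x,y\in\mathcal{X}}\|x-y\|_2\le D$ for some $D>0$. Let $\alpha>0$, $G>0$, and assume every loss $f_t$ is $\alpha$-exp-concave (i.e. $x\mapsto\exp(-\alpha f_t(x))$ is concave on $\mathcal{X}$) and satisfies $\max_{x\in\mathcal{X}}\|\nabla f_t(x)\|_2\le G$. Let $\beta=\frac12\min\{\frac{1}{4GD},\alpha\}$ and let $0<\eta_0\le\eta_1\le\dots\le\eta_T$ be learning rates. Consider the learner (Delayed ONS) that plays an arbitrary $x_1\in\mathcal{X}$ and, for each $t\ge1$, after observing $g_\tau$ for all $\tau\in o_{t+1}\setminus o_t$, plays $$x_{t+1}\in\arg\min_{x\in\mathcal{X}}\ \sum_{\tau\in o_{t+1}}\left(\langle g_\tau,x\rangle+\frac{\beta}{2}\langle g_\tau,x-x_\tau\rangle^2\right)+\frac{\eta_t}{2}\|x\|_2^2 .$$ Then $$\mathrm{Reg}_T=\mathcal{O}\left(\frac{n}{\beta}\ln\left(1+\frac{\beta G^2T}{\eta_0 n}\right)+\eta_T D^2+\min\{B_1,B_2\}\right),$$ where $B_1=\left(\frac{G^2}{\eta_0}+\frac1\beta\right)n\,d_{\max}\ln\left(1+\frac{\beta G^2T}{\eta_0 n}\right)$ and $B_2=G^2\sum_{t=1}^T\frac{|m_t|}{\eta_{t-1}}$; here $\mathcal{O}$ hides only an absolute numerical constant.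
   Context: Delayed OCO setting: $T\ge1$ and $n\ge1$ are integers, $[T]=\{1,\dots,T\}$. For each round $t\in[T]$ the learner chooses $x_t\in\mathcal{X}$ and incurs loss $f_t(x_t)$, where $f_t:\mathcal{X}\to\mathbb{R}$ is convex and differentiable (possibly adversarial). The gradient $g_t=\nabla f_t(x_t)$ is revealed to the learner only at the end of round $t+d_t$, where $d_t\in\{0,1,2,\dots\}$ is an arbitrary delay unknown to the learner, with $t+d_t\le T$ for all $t\in[T]$. For $t\ge1$ define $o_t=\{\tau\in\mathbb{N}:\tau+d_\tau<t\}\subseteq[t-1]$ and $m_t=[t-1]\setminus o_t$. Let $d_{\max}=\max_{t\in[T]}d_t$. The regret is $\mathrm{Reg}_T=\sup_{u\in\mathcal{X}}\sum_{t=1}^T(f_t(x_t)-f_t(u))$. The learning rate $\eta_t$ used to compute $x_{t+1}$ may depend on information available at the end of round $t$. *)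

theory Defs
  imports Complex_Main
begin

text \<open>Explicit model of R^n: vectors are functions nat => real vanishing outside {..<n}.
  This allows the dimension n to be an ordinary natural number, so that the absolute
  constant hidden in the O-notation can be quantified before n.\<close>

definition vec :: "nat \<Rightarrow> (nat \<Rightarrow> real) set" where
  "vec n = {x. \<forall>i\<ge>n. x i = 0}"

definition ip :: "nat \<Rightarrow> (nat \<Rightarrow> real) \<Rightarrow> (nat \<Rightarrow> real) \<Rightarrow> real" where
  "ip n x y = (\<Sum>i<n. x i * y i)"

definition nrm :: "nat \<Rightarrow> (nat \<Rightarrow> real) \<Rightarrow> real" where
  "nrm n x = sqrt (ip n x x)"

definition vdiff :: "(nat \<Rightarrow> real) \<Rightarrow> (nat \<Rightarrow> real) \<Rightarrow> (nat \<Rightarrow> real)" where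
  "vdiff x y = (\<lambda>i. x i - y i)"

definition comb :: "real \<Rightarrow> (nat \<Rightarrow> real) \<Rightarrow> (nat \<Rightarrow> real) \<Rightarrow> (nat \<Rightarrow> real)" where
  "comb a x y = (\<lambda>i. a * x i + (1 - a) * y i)"

definition convex_vset :: "(nat \<Rightarrow> real) set \<Rightarrow> bool" where
  "convex_vset X \<longleftrightarrow> (\<forall>x\<in>X. \<forall>y\<in>X. \<forall>a::real. 0 \<le> a \<and> a \<le> 1 \<longrightarrow> comb a x y \<in> X)"

definition closed_vset :: "nat \<Rightarrow> (nat \<Rightarrow> real) set \<Rightarrow> bool" where
  "closed_vset n X \<longleftrightarrow> (\<forall>s l. (\<forall>k. s k \<in> X) \<longrightarrow> l \<in> vec n \<longrightarrow>
      (\<lambda>k. nrm n (vdiff (s k) l)) \<longlonglongrightarrow> 0 \<longrightarrow> l \<in> X)"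

definition convex_fn :: "(nat \<Rightarrow> real) set \<Rightarrow> ((nat \<Rightarrow> real) \<Rightarrow> real) \<Rightarrow> bool" where
  "convex_fn X h \<longleftrightarrow> (\<forall>x\<in>X. \<forall>y\<in>X. \<forall>a::real. 0 \<le> a \<and> a \<le> 1 \<longrightarrow>
      h (comb a x y) \<le> a * h x + (1 - a) * h y)"

definition concave_fn :: "(nat \<Rightarrow> real) set \<Rightarrow> ((nat \<Rightarrow> real) \<Rightarrow> real) \<Rightarrow> bool" where
  "concave_fn X h \<longleftrightarrow> convex_fn X (\<lambda>x. - h x)"

definition has_grad :: "nat \<Rightarrow> ((nat \<Rightarrow> real) \<Rightarrow> real) \<Rightarrow> (nat \<Rightarrow> real) \<Rightarrow> (nat \<Rightarrow> real) \<Rightarrow> bool" where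
  "has_grad n h g x \<longleftrightarrow> g \<in> vec n \<and> (\<forall>\<epsilon>>0. \<exists>\<delta>>0. \<forall>y\<in>vec n. nrm n (vdiff y x) < \<delta> \<longrightarrow>
      \<bar>h y - h x - ip n g (vdiff y x)\<bar> \<le> \<epsilon> * nrm n (vdiff y x))"

definition obs :: "(nat \<Rightarrow> nat) \<Rightarrow> nat \<Rightarrow> nat set" where
  "obs d t = {\<tau>. 1 \<le> \<tau> \<and> \<tau> + d \<tau> < t}"

definition miss :: "(nat \<Rightarrow> nat) \<Rightarrow> nat \<Rightarrow> nat set" where
  "miss d t = {1..<t} - obs d t"

definition ons_obj :: "nat \<Rightarrow> real \<Rightarrow> (nat \<Rightarrow> nat) \<Rightarrow> (nat \<Rightarrow> nat \<Rightarrow> real) \<Rightarrow> (nat \<Rightarrow> nat \<Rightarrow> real)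
    \<Rightarrow> real \<Rightarrow> nat \<Rightarrow> (nat \<Rightarrow> real) \<Rightarrow> real" where
  "ons_obj n \<beta> d g x eta t y =
     (\<Sum>\<tau>\<in>obs d (t+1). ip n (g \<tau>) y + \<beta> / 2 * (ip n (g \<tau>) (vdiff y (x \<tau>)))^2)
     + eta / 2 * (nrm n y)^2"

end

(*
  Exp-concavity replaces each loss by a quadratic surrogate that agrees with it to first order at
  x_t. Compare x_t with the leader y_t minimizing all surrogates of rounds 1..t plus the regularizer
  of round t - 1: the leaders have regret at most eta_T D^2 / 2, so only the drift <g_t, x_t - y_t>
  remains. The objectives of x_t and y_t differ by the surrogates of the missing rounds and of round
  t, and strong convexity bounds the drift by |g_t| times the sum of |g_tau| over these rounds, in
  the dual norm of V_t = eta_0 I + beta * sum of g_s g_s^T over s <= t. The term |g_t|^2 is summed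
  by the log-determinant potential; a cross term is at most G^2 / eta_{t-1}, which gives B_2, and by
  AM-GM at most the average of two such squares, which gives B_1 since a round is missing at most
  d_max times.
*)
theory Submission
  imports Defs "HOL-Analysis.Convex"
begin

text \<open>The learner's own objective has only the curvature of the observed rounds, while the
  potential needs all of V_t. The gap closes because the leader's objective does have that curvature
  and the missing surrogates are exactly quadratic: adding the two optimality inequalities restores
  the full form. Giving \<open>y t\<close> the regularizer of \<open>x t\<close> keeps learning-rate
  increments out of this comparison; they are paid for in the be-the-leader step instead. A missing
  round \<tau> may be charged at its own potential because V_\<tau> is dominated by V_t for \<tau>
  \<le> t. Taking the minimum of both estimates pair by pair lets one decomposition serve B_1 and
  B_2 together. The two halves of \<beta> act separately: \<open>2 * \<beta> \<le> \<alpha>\<close>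
  lowers the exp-concavity parameter to \<open>2 * \<beta>\<close>, and
  \<open>8 * \<beta> * G * D \<le> 1\<close> keeps every surrogate gradient on the domain within the
  factor 9/8 of the revealed one.\<close>

section \<open>The log-determinant potential\<close>

text \<open>Determinants and inverses are avoided: with dimension an ordinary number, pivots are
  eliminated from the last coordinate downwards. For positive definite \<open>V\<close>, \<open>pivot_prod n V\<close> is
  \<open>det V\<close> and \<open>inv_form n V g\<close> is \<open>g\<^sup>T V\<^sup>-\<^sup>1 g\<close>.\<close>

definition schur :: "nat \<Rightarrow> (nat \<Rightarrow> nat \<Rightarrow> real) \<Rightarrow> nat \<Rightarrow> nat \<Rightarrow> real" where
  "schur n V = (\<lambda>i j. V i j - V i n * V j n / V n n)"

fun posdef :: "nat \<Rightarrow> (nat \<Rightarrow> nat \<Rightarrow> real) \<Rightarrow> bool" where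
  "posdef 0 V = True"
| "posdef (Suc n) V = (V n n > 0 \<and> posdef n (schur n V))"

fun pivot_prod :: "nat \<Rightarrow> (nat \<Rightarrow> nat \<Rightarrow> real) \<Rightarrow> real" where
  "pivot_prod 0 V = 1"
| "pivot_prod (Suc n) V = V n n * pivot_prod n (schur n V)"

fun inv_form :: "nat \<Rightarrow> (nat \<Rightarrow> nat \<Rightarrow> real) \<Rightarrow> (nat \<Rightarrow> real) \<Rightarrow> real" where
  "inv_form 0 V g = 0"
| "inv_form (Suc n) V g =
     (g n)\<^sup>2 / V n n + inv_form n (schur n V) (\<lambda>i. g i - V i n * g n / V n n)"

definition mform :: "nat \<Rightarrow> (nat \<Rightarrow> nat \<Rightarrow> real) \<Rightarrow> (nat \<Rightarrow> real) \<Rightarrow> real" where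
  "mform n V w = (\<Sum>i<n. \<Sum>j<n. V i j * w i * w j)"

lemma inv_form_nonneg: "posdef n V \<Longrightarrow> 0 \<le> inv_form n V g"
  by (induction n arbitrary: V g) auto

lemma pivot_prod_pos: "posdef n V \<Longrightarrow> 0 < pivot_prod n V"
  by (induction n arbitrary: V) auto

text \<open>Here \<open>a\<close> is the pivot, \<open>u\<close>, \<open>v\<close> are entries of
  its column and \<open>p\<close>, \<open>q\<close>, \<open>r\<close> entries of the update vector.
  Clearing the denominators leaves a polynomial identity.\<close>

lemma schur_entry_rank_one:
  fixes a c r p q u v z :: real
  assumes "a > 0" "a + c * r\<^sup>2 > 0"
  shows "z + c * p * q - (u + c * p * r) * (v + c * q * r) / (a + c * r\<^sup>2)
    = z - u * v / a + c * a / (a + c * r\<^sup>2) * (p - u * r / a) * (q - v * r / a)"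
proof -
  define s where "s = a + c * r\<^sup>2"
  have s: "s > 0" using assms by (simp add: s_def)
  have "c * p * q * s * a - (u + c * p * r) * (v + c * q * r) * a
      = - (u * v * s) + c * (p * a - u * r) * (q * a - v * r)"
    unfolding s_def by algebra
  then have e1: "(c * p * q * s * a - (u + c * p * r) * (v + c * q * r) * a) / (s * a)
      = (- (u * v * s) + c * (p * a - u * r) * (q * a - v * r)) / (s * a)"
    by simp
  have e2: "(c * p * q * s * a - (u + c * p * r) * (v + c * q * r) * a) / (s * a)
      = c * p * q - (u + c * p * r) * (v + c * q * r) / s"
    using s assms(1) by (simp add: diff_divide_distrib)
  have e3: "(- (u * v * s) + c * (p * a - u * r) * (q * a - v * r)) / (s * a)
      = - (u * v / a) + c * a / s * (p - u * r / a) * (q - v * r / a)"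
  proof -
    have pq: "p - u * r / a = (p * a - u * r) / a" "q - v * r / a = (q * a - v * r) / a"
      using assms(1) by (auto simp: diff_divide_distrib)
    have "c * P * Q / (s * a) = c * a / s * (P / a) * (Q / a)" for P Q
      using s assms(1) by simp
    then show ?thesis using s assms(1) unfolding pq add_divide_distrib by simp
  qed
  show ?thesis using trans[OF e2[symmetric] trans[OF e1 e3]] unfolding s_def by linarith
qed

text \<open>Rank-one updates survive elimination: only the weight changes, and the new vector is the
  one in the recursion of \<open>inv_form\<close>.\<close>

lemma schur_rank_one:
  assumes "V n n > 0" "c \<ge> 0"
  shows "schur n (\<lambda>i j. V i j + c * g i * g j) =
    (\<lambda>i j. schur n V i j + c * V n n / (V n n + c * (g n)\<^sup>2)
       * (g i - V i n * g n / V n n) * (g j - V j n * g n / V n n))"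
proof (intro ext)
  fix i j
  define a where "a = V n n"
  have a: "a > 0" and s: "a + c * (g n)\<^sup>2 > 0"
    using assms by (auto simp: a_def add_pos_nonneg)
  show "schur n (\<lambda>i j. V i j + c * g i * g j) i j =
    schur n V i j + c * V n n / (V n n + c * (g n)\<^sup>2)
       * (g i - V i n * g n / V n n) * (g j - V j n * g n / V n n)"
    using schur_entry_rank_one[OF a s, of "V i j" "g i" "g j" "V i n" "V j n"]
    by (simp add: schur_def a_def power2_eq_square mult.assoc)
qed

text \<open>The matrix determinant lemma, by induction on the pivots. The weight \<open>c\<close>
  has to be general because each elimination replaces it by \<open>k\<close>.\<close>

lemma rank_one_update:
  assumes "posdef n V" "c \<ge> 0"
  shows "posdef n (\<lambda>i j. V i j + c * g i * g j) \<and>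
    pivot_prod n (\<lambda>i j. V i j + c * g i * g j) = pivot_prod n V * (1 + c * inv_form n V g)"
  using assms
proof (induction n arbitrary: V g c)
  case 0
  then show ?case by simp
next
  case (Suc n)
  define a where "a = V n n"
  define k where "k = c * a / (a + c * (g n)\<^sup>2)"
  define h where "h = (\<lambda>i. g i - V i n * g n / V n n)"
  have a: "a > 0" and s: "a + c * (g n)\<^sup>2 > 0"
    using Suc.prems by (auto simp: a_def add_pos_nonneg)
  have k: "k \<ge> 0" using a s Suc.prems by (simp add: k_def)
  have sch: "schur n (\<lambda>i j. V i j + c * g i * g j) = (\<lambda>i j. schur n V i j + k * h i * h j)"
    using schur_rank_one[of V n c g] Suc.prems by (simp add: k_def a_def h_def)
  have IH: "posdef n (\<lambda>i j. schur n V i j + k * h i * h j)"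
    "pivot_prod n (\<lambda>i j. schur n V i j + k * h i * h j)
      = pivot_prod n (schur n V) * (1 + k * inv_form n (schur n V) h)"
    using Suc.IH[of "schur n V" k h] Suc.prems k by auto
  have corner: "V n n + c * g n * g n = a + c * (g n)\<^sup>2" by (simp add: a_def power2_eq_square)
  \<comment> \<open>The new pivot times the factor left after elimination equals the old pivot times
    the full factor.\<close>
  have "(a + c * (g n)\<^sup>2) * k = c * a"
    using s by (simp add: k_def)
  then have "(a + c * (g n)\<^sup>2) * (1 + k * I) = a + c * (g n)\<^sup>2 + c * a * I" for I
    by (simp add: distrib_left flip: mult.assoc)
  moreover have "a * (1 + c * ((g n)\<^sup>2 / a + I)) = a + c * (g n)\<^sup>2 + c * a * I" for I
    using a by (simp add: field_simps)
  ultimately have eq: "(a + c * (g n)\<^sup>2) * (1 + k * I) = a * (1 + c * ((g n)\<^sup>2 / a + I))" for I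
    by simp
  show ?case
    using IH s eq[of "inv_form n (schur n V) h"]
    by (simp add: sch corner mult.left_commute) (simp add: a_def h_def mult.left_commute mult.commute)
qed

text \<open>Hadamard's inequality: elimination subtracts a square divided by the pivot from each
  diagonal entry.\<close>

lemma pivot_prod_le_diag: "posdef n V \<Longrightarrow> pivot_prod n V \<le> (\<Prod>i<n. V i i)"
proof (induction n arbitrary: V)
  case 0
  then show ?case by simp
next
  case (Suc n)
  have a: "V n n > 0" and p: "posdef n (schur n V)" using Suc.prems by auto
  have diag: "0 < W i i" if "posdef m W" "i < m" for m i W
    using that
  proof (induction m arbitrary: W)
    case (Suc m)
    show ?case
    proof (cases "i = m")
      case False
      then have "0 < schur m W i i" using Suc by auto
      also have "\<dots> \<le> W i i" using Suc.prems by (simp add: schur_def)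
      finally show ?thesis .
    qed (use Suc.prems in auto)
  qed simp
  have "pivot_prod n (schur n V) \<le> (\<Prod>i<n. schur n V i i)" using Suc.IH p by blast
  also have "\<dots> \<le> (\<Prod>i<n. V i i)"
    using a diag[OF p] by (intro prod_mono) (force simp: schur_def)
  finally show ?case using a by (simp add: mult.commute)
qed

text \<open>Cauchy-Schwarz for two blocks: the pivot direction of weight \<open>a\<close> and the
  remaining coordinates. \<open>A\<close> and \<open>B\<close> are the mixed products on the right,
  and AM-GM bounds the cross term by their sum.\<close>

lemma quad_cauchy_step:
  fixes a M q P r u :: real
  assumes "a > 0" "q \<ge> 0" "M \<ge> 0" "P\<^sup>2 \<le> q * M"
  shows "(P + r * u)\<^sup>2 \<le> (r\<^sup>2 / a + q) * (a * u\<^sup>2 + M)"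
proof -
  define A where "A = r\<^sup>2 / a * M"
  define B where "B = q * (a * u\<^sup>2)"
  have AB: "A \<ge> 0" "B \<ge> 0" using assms by (auto simp: A_def B_def)
  have "(2 * P * (r * u))\<^sup>2 = 4 * P\<^sup>2 * (r * u)\<^sup>2" by (simp add: power_mult_distrib)
  also have "\<dots> \<le> 4 * (q * M) * (r * u)\<^sup>2" using assms by (intro mult_right_mono) auto
  also have "\<dots> = 4 * A * B" using assms(1) by (simp add: A_def B_def power_mult_distrib)
  also have "\<dots> \<le> (A + B)\<^sup>2" using sum_squares_ge_zero[of "A - B" 0] by (simp add: power2_eq_square algebra_simps)
  finally have "2 * P * (r * u) \<le> A + B" by (rule power2_le_imp_le) (use AB in simp)
  moreover have "(r\<^sup>2 / a + q) * (a * u\<^sup>2 + M) = (r * u)\<^sup>2 + A + B + q * M"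
    using assms(1) by (simp add: A_def B_def power_mult_distrib algebra_simps)
  ultimately show ?thesis using assms(4) by (simp add: power2_sum)
qed

lemma inv_form_cauchy_schwarz:
  assumes "posdef n V" "\<And>i j. V i j = V j i"
  shows "0 \<le> mform n V w \<and> (ip n g w)\<^sup>2 \<le> inv_form n V g * mform n V w"
  using assms
proof (induction n arbitrary: V g)
  case 0
  then show ?case by (simp add: ip_def mform_def)
next
  case (Suc n)
  define a where "a = V n n"
  define h where "h = (\<lambda>i. g i - V i n * g n / V n n)"
  define b where "b = (\<Sum>i<n. V i n * w i)"
  have a: "a > 0" and p: "posdef n (schur n V)" using Suc.prems by (auto simp: a_def)
  have sym: "schur n V i j = schur n V j i" for i j
    using Suc.prems(2)[of i j] by (simp add: schur_def)
  have IH: "0 \<le> mform n (schur n V) w"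
    "(ip n h w)\<^sup>2 \<le> inv_form n (schur n V) h * mform n (schur n V) w"
    using Suc.IH[OF p sym] by auto
  have "mform n (schur n V) w = mform n V w - (\<Sum>i<n. \<Sum>j<n. (V i n * w i) * (V j n * w j) / a)"
    unfolding mform_def schur_def a_def sum_subtractf[symmetric]
    by (intro sum.cong refl) (simp add: field_simps)
  also have "(\<Sum>i<n. \<Sum>j<n. (V i n * w i) * (V j n * w j) / a) = b\<^sup>2 / a"
    by (simp add: b_def power2_eq_square sum_product sum_divide_distrib)
  finally have M: "mform n (schur n V) w = mform n V w - b\<^sup>2 / a" .
  have row: "(\<Sum>j<n. V n j * w n * w j) = w n * b" "(\<Sum>i<n. V i n * w i * w n) = w n * b"
    unfolding b_def sum_distrib_left
    by (intro sum.cong refl; simp add: Suc.prems(2)[of n])+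
  have "mform (Suc n) V w = mform n V w + 2 * w n * b + a * (w n)\<^sup>2"
    by (simp add: mform_def sum.distrib row a_def power2_eq_square)
  \<comment> \<open>Completing the square in the last coordinate; the linear form below splits along
    the same shifted coordinate \<open>w n + b / a\<close>.\<close>
  then have M': "mform (Suc n) V w = a * (w n + b / a)\<^sup>2 + mform n (schur n V) w"
    using a unfolding M by (simp add: power2_eq_square field_simps)
  have "ip n h w = ip n g w - g n * (b / a)"
    unfolding ip_def h_def b_def a_def sum_divide_distrib sum_distrib_left sum_subtractf[symmetric]
    by (intro sum.cong refl) (simp add: algebra_simps)
  then have "ip (Suc n) g w = ip n h w + g n * (w n + b / a)"
    by (simp add: ip_def algebra_simps)
  moreover have "inv_form (Suc n) V g = (g n)\<^sup>2 / a + inv_form n (schur n V) h"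
    by (simp add: a_def h_def)
  ultimately show ?case
    using quad_cauchy_step[OF a inv_form_nonneg[OF p] IH] M' IH(1) a by simp
qed

section \<open>Regularized Gram matrices of gradients and their log-determinants\<close>

definition qform :: "nat \<Rightarrow> real \<Rightarrow> (nat \<Rightarrow> nat \<Rightarrow> real) \<Rightarrow> nat set \<Rightarrow> real \<Rightarrow> (nat \<Rightarrow> real) \<Rightarrow> real" where
  "qform n \<beta> g S e w = \<beta> * (\<Sum>\<tau>\<in>S. (ip n (g \<tau>) w)\<^sup>2) + e * ip n w w"

definition gram :: "real \<Rightarrow> (nat \<Rightarrow> nat \<Rightarrow> real) \<Rightarrow> real \<Rightarrow> nat \<Rightarrow> nat \<Rightarrow> nat \<Rightarrow> real" where
  "gram \<beta> g e t = (\<lambda>i j. (if i = j then e else 0) + \<beta> * (\<Sum>\<tau>=1..t. g \<tau> i * g \<tau> j))"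

lemma ip_nonneg: "0 \<le> ip n x x"
  by (simp add: ip_def sum_nonneg)

lemma nrm_sq: "(nrm n x)\<^sup>2 = ip n x x"
  by (simp add: nrm_def ip_nonneg)

lemma mform_gram: "mform n (gram \<beta> g e t) w = qform n \<beta> g {1..t} e w"
proof -
  have "mform n (gram \<beta> g e t) w = (\<Sum>i<n. \<Sum>j<n. if i = j then e * w i * w j else 0)
      + (\<Sum>i<n. \<Sum>j<n. \<Sum>\<tau>=1..t. \<beta> * (g \<tau> i * w i) * (g \<tau> j * w j))"
    unfolding mform_def gram_def sum.distrib[symmetric]
    by (intro sum.cong refl) (auto simp add: distrib_right sum_distrib_left sum_distrib_right mult_ac distrib_left)
  also have "(\<Sum>i<n. \<Sum>j<n. if i = j then e * w i * w j else 0) = e * ip n w w"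
    by (simp add: ip_def sum_distrib_left mult.assoc)
  also have "(\<Sum>i<n. \<Sum>j<n. \<Sum>\<tau>=1..t. \<beta> * (g \<tau> i * w i) * (g \<tau> j * w j))
      = (\<Sum>i<n. \<Sum>\<tau>=1..t. \<Sum>j<n. \<beta> * ((g \<tau> i * w i) * (g \<tau> j * w j)))"
    unfolding mult.assoc by (intro sum.cong refl sum.swap)
  also have "\<dots> = (\<Sum>\<tau>=1..t. \<Sum>i<n. \<Sum>j<n. \<beta> * ((g \<tau> i * w i) * (g \<tau> j * w j)))"
    by (rule sum.swap)
  also have "\<dots> = \<beta> * (\<Sum>\<tau>=1..t. (ip n (g \<tau>) w)\<^sup>2)"
    by (simp only: ip_def power2_eq_square sum_product) (simp only: sum_distrib_left)
  finally show ?thesis by (simp add: qform_def)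
qed

text \<open>Eliminating from a diagonal matrix changes its pivot row and column, so
  \<open>gram_0\<close> can compare the matrices only on indices below \<open>n\<close>.\<close>

lemma pivot_cong:
  assumes "\<And>i j. i < n \<Longrightarrow> j < n \<Longrightarrow> V i j = W i j"
  shows "posdef n V = posdef n W" "pivot_prod n V = pivot_prod n W"
proof -
  have "posdef n V = posdef n W \<and> pivot_prod n V = pivot_prod n W"
    using assms
  proof (induction n arbitrary: V W)
    case (Suc n)
    show ?case using Suc.IH[of "schur n V" "schur n W"] Suc.prems by (simp add: schur_def)
  qed simp
  then show "posdef n V = posdef n W" "pivot_prod n V = pivot_prod n W" by auto
qed

lemma gram_0:
  assumes "e > 0"
  shows "posdef n (gram \<beta> g e 0) \<and> pivot_prod n (gram \<beta> g e 0) = e ^ n"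
proof (induction n)
  case (Suc n)
  have "schur n (gram \<beta> g e 0) i j = gram \<beta> g e 0 i j" if "i < n" "j < n" for i j
    using that by (simp add: schur_def gram_def)
  note pivot_cong[OF this]
  moreover have "gram \<beta> g e 0 n n = e" by (simp add: gram_def)
  ultimately show ?case using Suc assms by simp
qed simp

lemma gram_Suc:
  "gram \<beta> g e (Suc t) = (\<lambda>i j. gram \<beta> g e t i j + \<beta> * g (Suc t) i * g (Suc t) j)"
  by (auto simp: gram_def fun_eq_iff algebra_simps)

lemma gram_posdef:
  assumes "\<beta> > 0" "e > 0"
  shows "posdef n (gram \<beta> g e t)"
proof (induction t)
  case (Suc t)
  then show ?case using rank_one_update[of n "gram \<beta> g e t" \<beta>] assms(1) by (simp add: gram_Suc)
qed (use gram_0 assms(2) in blast)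

lemma log_det_bound:
  assumes "n \<ge> 1" "\<beta> > 0" "e > 0" and G: "\<And>t. t \<in> {1..T} \<Longrightarrow> ip n (g t) (g t) \<le> G\<^sup>2"
  shows "ln (pivot_prod n (gram \<beta> g e T)) \<le> n * ln e + n * ln (1 + \<beta> * G\<^sup>2 * real T / (e * n))"
proof -
  define V where "V = gram \<beta> g e T"
  \<comment> \<open>\<open>c\<close> bounds the average diagonal entry, since the trace is at most
    \<open>n * e + \<beta> * T * G\<^sup>2\<close>.\<close>
  define c where "c = e + \<beta> * G\<^sup>2 * T / n"
  have pos: "posdef n (gram \<beta> g e t)" for t by (rule gram_posdef[OF assms(2,3)])
  have c: "c > 0" using assms(1-3) by (auto simp: c_def intro: add_pos_nonneg)
  have Vii: "V i i > 0" for i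
    using assms(2,3) sum_nonneg[of "{1..T}" "\<lambda>\<tau>. g \<tau> i * g \<tau> i"]
    by (auto simp: V_def gram_def intro!: add_pos_nonneg)
  have "(\<Sum>i<n. V i i) = n * e + \<beta> * (\<Sum>i<n. \<Sum>t=1..T. g t i * g t i)"
    by (simp add: V_def gram_def sum.distrib sum_distrib_left)
  also have "(\<Sum>i<n. \<Sum>t=1..T. g t i * g t i) = (\<Sum>t=1..T. ip n (g t) (g t))"
    unfolding ip_def by (rule sum.swap)
  also have "\<dots> \<le> T * G\<^sup>2" using sum_bounded_above[of "{1..T}" "\<lambda>t. ip n (g t) (g t)", OF G] by simp
  also have "n * e + \<beta> * (T * G\<^sup>2) = n * c" using assms(1) by (simp add: c_def field_simps)
  finally have tr: "(\<Sum>i<n. V i i) \<le> n * c" using assms(2) by simp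
  have "ln (pivot_prod n V) \<le> ln (\<Prod>i<n. V i i)"
    using pivot_prod_le_diag[OF pos] pivot_prod_pos[OF pos] Vii
    by (subst ln_le_cancel_iff) (auto simp: V_def intro!: prod_pos)
  also have "\<dots> = (\<Sum>i<n. ln (V i i))" using Vii by (intro ln_prod) (auto simp: less_le)
  \<comment> \<open>Jensen's inequality by way of the tangent of \<open>ln\<close> at
    \<open>c\<close>; the trace bound makes the linear part nonpositive.\<close>
  also have "\<dots> \<le> (\<Sum>i<n. V i i / c - 1 + ln c)"
  proof (intro sum_mono)
    fix i
    have "ln (V i i) = ln (V i i / c) + ln c" using Vii[of i] c by (simp add: ln_div)
    also have "ln (V i i / c) \<le> V i i / c - 1" using Vii c by (intro ln_le_minus_one) simp
    finally show "ln (V i i) \<le> V i i / c - 1 + ln c" by simp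
  qed
  also have "\<dots> = (\<Sum>i<n. V i i) / c - n + n * ln c"
    by (simp add: sum.distrib sum_subtractf sum_divide_distrib)
  also have "\<dots> \<le> n * ln c" using tr c by (simp add: field_simps)
  also have "c = e * (1 + \<beta> * G\<^sup>2 * real T / (e * n))" using assms(1,3) by (simp add: c_def field_simps)
  also have "ln \<dots> = ln e + ln (1 + \<beta> * G\<^sup>2 * real T / (e * n))"
    using assms(1-3) by (intro ln_mult_pos) (auto intro: add_pos_nonneg)
  finally show "ln (pivot_prod n (gram \<beta> g e T)) \<le> n * ln e + n * ln (1 + \<beta> * G\<^sup>2 * real T / (e * n))"
    by (simp add: V_def distrib_left)
qed

text \<open>\<open>p t\<close> stands for the squared dual norm of \<open>g t\<close> with respect
  to the matrix that already contains round \<open>t\<close>. Only its Cauchy-Schwarz inequality and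
  its sum are exported, so the regret analysis needs no matrices.\<close>

lemma elliptical_potential:
  assumes "n \<ge> 1" "\<beta> > 0" "e > 0" and G: "\<And>t. t \<in> {1..T} \<Longrightarrow> ip n (g t) (g t) \<le> G\<^sup>2"
  obtains p where "\<And>t. 0 \<le> p t"
    "\<And>t w. t \<ge> 1 \<Longrightarrow> (ip n (g t) w)\<^sup>2 \<le> p t * qform n \<beta> g {1..t} e w"
    "(\<Sum>t=1..T. p t) \<le> n / \<beta> * ln (1 + \<beta> * G\<^sup>2 * real T / (e * n))"
proof -
  define s where "s t = inv_form n (gram \<beta> g e (t - 1)) (g t)" for t
  \<comment> \<open>Sherman-Morrison: \<open>s t\<close> is the squared dual norm before round
    \<open>t\<close> is added, \<open>p t\<close> the one after.\<close>
  define p where "p t = s t / (1 + \<beta> * s t)" for t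
  have pos: "posdef n (gram \<beta> g e t)" for t by (rule gram_posdef[OF assms(2,3)])
  have s: "s t \<ge> 0" for t using inv_form_nonneg[OF pos] by (simp add: s_def)
  then have s1: "1 + \<beta> * s t > 0" for t using assms(2) by (intro add_pos_nonneg) auto
  have 1: "0 \<le> p t" for t using s s1 by (simp add: p_def less_imp_le)
  have 2: "(ip n (g t) w)\<^sup>2 \<le> p t * qform n \<beta> g {1..t} e w" if "t \<ge> 1" for t w
  proof -
    obtain u where t: "t = Suc u" using \<open>t \<ge> 1\<close> not0_implies_Suc[of t] by auto
    have "gram \<beta> g e u i j = gram \<beta> g e u j i" for i j by (simp add: gram_def mult.commute)
    then have "(ip n (g t) w)\<^sup>2 \<le> s t * qform n \<beta> g {1..u} e w"
      using inv_form_cauchy_schwarz[OF pos, of u w "g t"] by (simp add: mform_gram s_def t)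
    moreover have "qform n \<beta> g {1..t} e w = qform n \<beta> g {1..u} e w + \<beta> * (ip n (g t) w)\<^sup>2"
      by (simp add: qform_def t algebra_simps)
    ultimately have "(ip n (g t) w)\<^sup>2 * (1 + \<beta> * s t) \<le> s t * qform n \<beta> g {1..t} e w"
      by (simp add: algebra_simps)
    then show ?thesis using s1[of t] by (simp add: p_def pos_le_divide_eq)
  qed
  have ln_det: "ln (pivot_prod n (gram \<beta> g e t)) = n * ln e + (\<Sum>\<tau>=1..t. ln (1 + \<beta> * s \<tau>))" for t
  proof (induction t)
    case 0
    then show ?case using gram_0[OF assms(3)] by (simp add: ln_realpow)
  next
    case (Suc t)
    have "pivot_prod n (gram \<beta> g e (Suc t)) = pivot_prod n (gram \<beta> g e t) * (1 + \<beta> * s (Suc t))"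
      using rank_one_update[OF pos, of \<beta> t "g (Suc t)"] assms(2) by (simp add: gram_Suc s_def)
    then show ?case using Suc s1[of "Suc t"] pivot_prod_pos[OF pos, of t] by (simp add: ln_mult_pos)
  qed
  \<comment> \<open>\<open>\<beta> * p t\<close> is 1 minus the ratio of consecutive determinants,
    so \<open>ln v \<le> v - 1\<close> at that ratio gives the bound and the logarithms
    telescope.\<close>
  have "\<beta> * p t \<le> ln (1 + \<beta> * s t)" for t
  proof -
    have "ln (1 / (1 + \<beta> * s t)) \<le> 1 / (1 + \<beta> * s t) - 1" using s1 by (intro ln_le_minus_one) simp
    moreover have "\<beta> * p t = 1 - 1 / (1 + \<beta> * s t)" using s1[of t] by (simp add: p_def field_simps)
    ultimately show ?thesis using s1[of t] by (simp add: ln_div)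
  qed
  then have "\<beta> * (\<Sum>t=1..T. p t) \<le> (\<Sum>t=1..T. ln (1 + \<beta> * s t))"
    unfolding sum_distrib_left by (intro sum_mono)
  also have "\<dots> \<le> n * ln (1 + \<beta> * G\<^sup>2 * real T / (e * n))"
    using log_det_bound[OF assms, of T "\<lambda>t. t"] ln_det[of T] by simp
  finally have 3: "(\<Sum>t=1..T. p t) \<le> n / \<beta> * ln (1 + \<beta> * G\<^sup>2 * real T / (e * n))"
    using assms(2) by (simp add: field_simps)
  show ?thesis by (rule that[OF 1 2 3])
qed

section \<open>Regularized surrogate objectives and their minimizers\<close>

text \<open>The constant that would make the value at \<open>c\<close> equal to the loss is dropped,
  so this is literally a summand of \<open>ons_obj\<close>; only differences of values
  matter.\<close>

definition surr :: "nat \<Rightarrow> real \<Rightarrow> (nat \<Rightarrow> real) \<Rightarrow> (nat \<Rightarrow> real) \<Rightarrow> (nat \<Rightarrow> real) \<Rightarrow> real" where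
  "surr n \<beta> g c y = ip n g y + \<beta> / 2 * (ip n g (vdiff y c))\<^sup>2"

definition reg_obj :: "nat \<Rightarrow> real \<Rightarrow> (nat \<Rightarrow> nat \<Rightarrow> real) \<Rightarrow> (nat \<Rightarrow> nat \<Rightarrow> real)
    \<Rightarrow> nat set \<Rightarrow> real \<Rightarrow> (nat \<Rightarrow> real) \<Rightarrow> real" where
  "reg_obj n \<beta> g x S e y = (\<Sum>\<tau>\<in>S. surr n \<beta> (g \<tau>) (x \<tau>) y) + e / 2 * (nrm n y)\<^sup>2"

definition minimizer :: "('a \<Rightarrow> real) \<Rightarrow> 'a set \<Rightarrow> 'a \<Rightarrow> bool" where
  "minimizer h X y \<longleftrightarrow> y \<in> X \<and> (\<forall>z\<in>X. h y \<le> h z)"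

lemma ons_obj_eq: "ons_obj n \<beta> d g x e t = reg_obj n \<beta> g x (obs d (t + 1)) e"
  by (simp add: ons_obj_def reg_obj_def surr_def fun_eq_iff)

lemma ip_comb: "ip n g (comb a y z) = a * ip n g y + (1 - a) * ip n g z"
  unfolding ip_def comb_def sum_distrib_left sum.distrib[symmetric]
  by (intro sum.cong refl) (simp add: algebra_simps)

lemma ip_vdiff: "ip n g (vdiff y z) = ip n g y - ip n g z"
  by (simp add: ip_def vdiff_def sum_subtractf algebra_simps)

lemma quad_comb:
  fixes a u v :: real
  shows "(a * u + (1 - a) * v)\<^sup>2 = a * u\<^sup>2 + (1 - a) * v\<^sup>2 - a * (1 - a) * (u - v)\<^sup>2"
  by algebra

lemma ip_self_comb:
  "ip n (comb a y z) (comb a y z)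
    = a * ip n y y + (1 - a) * ip n z z - a * (1 - a) * ip n (vdiff y z) (vdiff y z)"
  unfolding ip_def comb_def vdiff_def sum_distrib_left sum.distrib[symmetric] sum_subtractf[symmetric]
  by (intro sum.cong refl) (simp add: algebra_simps)

lemma surr_comb:
  "surr n \<beta> g c (comb a y z) = a * surr n \<beta> g c y + (1 - a) * surr n \<beta> g c z
    - a * (1 - a) / 2 * (\<beta> * (ip n g (vdiff y z))\<^sup>2)"
proof -
  define u where "u = ip n g y - ip n g c"
  define v where "v = ip n g z - ip n g c"
  have e: "ip n g y = u + ip n g c" "ip n g z = v + ip n g c" by (auto simp: u_def v_def)
  have "a * (u + c) + (1 - a) * (v + c) - c = a * u + (1 - a) * v" for c
    by (simp add: algebra_simps)
  then show ?thesis
    by (simp add: surr_def ip_comb ip_vdiff e quad_comb) (simp add: field_simps)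
qed

text \<open>The objective is quadratic with Hessian form \<open>qform\<close>, so its convexity
  defect on a segment is exact. Strong convexity is used in this form throughout, without
  derivatives.\<close>

lemma reg_obj_comb:
  "reg_obj n \<beta> g x S e (comb a y z) = a * reg_obj n \<beta> g x S e y + (1 - a) * reg_obj n \<beta> g x S e z
    - a * (1 - a) / 2 * qform n \<beta> g S e (vdiff y z)"
proof -
  have "(\<Sum>\<tau>\<in>S. surr n \<beta> (g \<tau>) (x \<tau>) (comb a y z))
    = a * (\<Sum>\<tau>\<in>S. surr n \<beta> (g \<tau>) (x \<tau>) y) + (1 - a) * (\<Sum>\<tau>\<in>S. surr n \<beta> (g \<tau>) (x \<tau>) z)
      - a * (1 - a) / 2 * (\<beta> * (\<Sum>\<tau>\<in>S. (ip n (g \<tau>) (vdiff y z))\<^sup>2))"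
    unfolding surr_comb sum_distrib_left sum_subtractf sum.distrib ..
  then show ?thesis
    unfolding reg_obj_def qform_def nrm_sq ip_self_comb by (simp add: field_simps)
qed

lemma qform_nonneg: "\<beta> \<ge> 0 \<Longrightarrow> e \<ge> 0 \<Longrightarrow> 0 \<le> qform n \<beta> g S e w"
  by (simp add: qform_def ip_nonneg sum_nonneg)

lemma qform_ge: "\<beta> \<ge> 0 \<Longrightarrow> e * ip n w w \<le> qform n \<beta> g S e w"
  by (simp add: qform_def sum_nonneg)

lemma qform_mono:
  "\<beta> \<ge> 0 \<Longrightarrow> finite S' \<Longrightarrow> S \<subseteq> S' \<Longrightarrow> e \<le> e' \<Longrightarrow> qform n \<beta> g S e w \<le> qform n \<beta> g S' e' w"
  unfolding qform_def by (intro add_mono mult_left_mono mult_right_mono sum_mono2 ip_nonneg) auto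

lemma qform_vdiff_swap: "qform n \<beta> g S e (vdiff y z) = qform n \<beta> g S e (vdiff z y)"
proof -
  have "ip n (vdiff y z) (vdiff y z) = ip n (vdiff z y) (vdiff z y)"
    by (simp add: ip_def vdiff_def algebra_simps)
  then show ?thesis by (simp add: qform_def ip_vdiff power2_commute)
qed

lemma minimizer_growth:
  assumes "convex_vset X" "minimizer (reg_obj n \<beta> g x S e) X y" "z \<in> X"
  shows "reg_obj n \<beta> g x S e y + qform n \<beta> g S e (vdiff z y) / 2 \<le> reg_obj n \<beta> g x S e z"
proof -
  define h where "h = reg_obj n \<beta> g x S e"
  define Q where "Q = qform n \<beta> g S e (vdiff z y)"
  \<comment> \<open>Minimality is tested at a point a fraction \<open>a\<close> of the way to
    \<open>z\<close> and divided by \<open>a\<close>; letting \<open>a\<close> tend to 0 recovers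
    the full constant 1/2.\<close>
  have "(1 - a) / 2 * Q \<le> h z - h y" if "0 < a" "a < 1" for a
  proof -
    have "comb a z y \<in> X" using assms that by (auto simp: convex_vset_def minimizer_def)
    then have "h y \<le> h (comb a z y)" using assms(2) by (auto simp: minimizer_def h_def)
    also have "\<dots> = a * h z + (1 - a) * h y - a * (1 - a) / 2 * Q"
      by (simp add: h_def Q_def reg_obj_comb)
    finally have "a * ((1 - a) / 2 * Q) \<le> a * (h z - h y)" by (simp add: algebra_simps)
    then show ?thesis using that by simp
  qed
  then have ev: "eventually (\<lambda>a. (1 - a) / 2 * Q \<le> h z - h y) (at_right 0)"
    by (auto simp: eventually_at_right_field intro!: exI[of _ 1])
  have "((\<lambda>a::real. (1 - a) / 2 * Q) \<longlongrightarrow> (1 - 0) / 2 * Q) (at_right 0)"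
    by (intro tendsto_intros) auto
  from tendsto_upperbound[OF this ev] have "Q / 2 \<le> h z - h y" by simp
  then show ?thesis by (simp add: h_def Q_def)
qed

text \<open>Completing the square; this makes the infimum in \<open>minimizer_exists\<close>
  finite.\<close>

lemma surr_bounded_below:
  assumes "\<beta> > 0" shows "surr n \<beta> g c y \<ge> ip n g c - 1 / (2 * \<beta>)"
proof -
  define u where "u = ip n g (vdiff y c)"
  have "0 \<le> (1 + \<beta> * u)\<^sup>2 / (2 * \<beta>)" using assms by simp
  also have "\<dots> = u + \<beta> / 2 * u\<^sup>2 + 1 / (2 * \<beta>)"
    using assms by (simp add: field_simps power2_eq_square)
  finally show ?thesis by (simp add: surr_def u_def ip_vdiff)
qed

lemma tendsto_ip:
  assumes "\<And>i. (\<lambda>k. s k i) \<longlonglongrightarrow> l i"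
  shows "(\<lambda>k. ip n g (s k)) \<longlonglongrightarrow> ip n g l"
  unfolding ip_def using assms by (intro tendsto_intros)

lemma tendsto_ip_self:
  assumes "\<And>i. (\<lambda>k. s k i) \<longlonglongrightarrow> l i"
  shows "(\<lambda>k. ip n (s k) (s k)) \<longlonglongrightarrow> ip n l l"
  unfolding ip_def using assms by (intro tendsto_intros)

lemma coord_le_ip: "i < n \<Longrightarrow> (w i)\<^sup>2 \<le> ip n w w"
  unfolding ip_def power2_eq_square by (rule member_le_sum) auto

text \<open>Strong convexity makes every minimizing sequence Cauchy, so no compactness is needed.\<close>

lemma minimizer_exists:
  assumes X: "X \<subseteq> vec n" "X \<noteq> {}" "closed_vset n X" "convex_vset X"
    and pos: "\<beta> > 0" "e > 0"
  obtains y where "minimizer (reg_obj n \<beta> g x S e) X y"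
proof -
  define h where "h = reg_obj n \<beta> g x S e"
  define m where "m = Inf (h ` X)"
  have "(\<Sum>\<tau>\<in>S. ip n (g \<tau>) (x \<tau>) - 1 / (2 * \<beta>)) \<le> h y" for y
  proof -
    have "(\<Sum>\<tau>\<in>S. ip n (g \<tau>) (x \<tau>) - 1 / (2 * \<beta>)) \<le> (\<Sum>\<tau>\<in>S. surr n \<beta> (g \<tau>) (x \<tau>) y)"
      by (intro sum_mono surr_bounded_below pos)
    then show ?thesis using pos by (simp add: h_def reg_obj_def add_increasing2)
  qed
  then have bdd: "bdd_below (h ` X)" by (auto intro!: bdd_belowI)
  have mle: "m \<le> h y" if "y \<in> X" for y
    unfolding m_def using that bdd by (intro cInf_lower) auto
  have "\<exists>y\<in>X. h y < m + 1 / real (Suc k)" for k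
    using cInf_lessD[of "h ` X" "m + 1 / real (Suc k)"] X(2) by (auto simp: m_def)
  then obtain s where s: "\<And>k. s k \<in> X" "\<And>k. h (s k) < m + 1 / real (Suc k)" by metis
  have close: "ip n (vdiff (s j) (s k)) (vdiff (s j) (s k)) \<le> 4 / e * (1 / real (Suc j) + 1 / real (Suc k))" for j k
  proof -
    \<comment> \<open>The value at the midpoint is at least the infimum, so the convexity defect
      there is at most the average excess of the two endpoints.\<close>
    have "comb (1/2) (s j) (s k) \<in> X" using X(4) s by (auto simp: convex_vset_def)
    from mle[OF this] have "m \<le> (h (s j) + h (s k)) / 2 - qform n \<beta> g S e (vdiff (s j) (s k)) / 8"
      by (simp add: h_def reg_obj_comb field_simps)
    then have "e * ip n (vdiff (s j) (s k)) (vdiff (s j) (s k)) \<le> 4 * (1 / real (Suc j) + 1 / real (Suc k))"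
      using s(2)[of j] s(2)[of k] qform_ge[of \<beta> e n "vdiff (s j) (s k)" g S] pos by argo
    then show ?thesis using pos by (simp add: pos_le_divide_eq mult.commute)
  qed
  have "Cauchy (\<lambda>k. s k i)" if "i < n" for i
  proof (rule metric_CauchyI)
    fix r :: real assume r: "r > 0"
    obtain N :: nat where N: "8 / (e * r\<^sup>2) < N" using reals_Archimedean2 by blast
    have "dist (s j i) (s k i) < r" if "j \<ge> N" "k \<ge> N" for j k
    proof -
      have Npos: "real N > 0" using N r pos less_trans[of 0 "8 / (e * r\<^sup>2)" "real N"] by simp
      have le: "1 / real (Suc j) \<le> 1 / N" "1 / real (Suc k) \<le> 1 / N"
        using Npos that by (auto simp: field_simps)
      have "(s j i - s k i)\<^sup>2 \<le> 4 / e * (1 / real (Suc j) + 1 / real (Suc k))"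
        using coord_le_ip[OF \<open>i < n\<close>, of "vdiff (s j) (s k)"] close[of j k] by (simp add: vdiff_def)
      also have "\<dots> \<le> 4 / e * (1 / N + 1 / N)"
        using le pos by (intro mult_left_mono add_mono) auto
      also have "\<dots> < r\<^sup>2" using N Npos r pos by (simp add: field_simps)
      finally have "\<bar>s j i - s k i\<bar>\<^sup>2 < r\<^sup>2" by (simp only: power2_abs)
      then have "\<bar>s j i - s k i\<bar> < r" by (rule power2_less_imp_less) (use r in simp)
      then show ?thesis by (simp add: dist_real_def)
    qed
    then show "\<exists>M. \<forall>m\<ge>M. \<forall>n\<ge>M. dist (s m i) (s n i) < r" by blast
  qed
  \<comment> \<open>Coordinates from \<open>n\<close> on are constantly zero, which puts the limit
    into \<open>vec n\<close> as \<open>closed_vset\<close> demands.\<close>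
  then have "\<forall>i. \<exists>l. (\<lambda>k. s k i) \<longlonglongrightarrow> l \<and> (i \<ge> n \<longrightarrow> l = 0)"
  proof (intro allI)
    fix i
    assume C: "\<And>i. i < n \<Longrightarrow> Cauchy (\<lambda>k. s k i)"
    show "\<exists>l. (\<lambda>k. s k i) \<longlonglongrightarrow> l \<and> (i \<ge> n \<longrightarrow> l = 0)"
    proof (cases "i < n")
      case True
      then show ?thesis using Cauchy_convergent[OF C] by (auto simp: convergent_def)
    next
      case False
      then have "s k i = 0" for k using s(1)[of k] X(1) by (auto simp: vec_def)
      then show ?thesis by auto
    qed
  qed
  then obtain l where l: "\<And>i. (\<lambda>k. s k i) \<longlonglongrightarrow> l i" "\<And>i. i \<ge> n \<Longrightarrow> l i = 0" by metis
  have "(\<lambda>k. nrm n (vdiff (s k) l)) \<longlonglongrightarrow> sqrt (ip n (\<lambda>i. l i - l i) (\<lambda>i. l i - l i))"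
    unfolding nrm_def vdiff_def by (intro tendsto_real_sqrt tendsto_ip_self tendsto_diff l tendsto_const)
  then have "l \<in> X" using X(3) s(1) l(2) by (auto simp: closed_vset_def vec_def ip_def)
  have "(\<lambda>k. h (s k)) \<longlonglongrightarrow> h l"
    unfolding h_def reg_obj_def surr_def nrm_sq ip_vdiff
    by (intro tendsto_intros tendsto_ip tendsto_ip_self l)
  moreover have "(\<lambda>k. m + 1 / real (Suc k)) \<longlonglongrightarrow> m + 0"
    using LIMSEQ_inverse_real_of_nat by (intro tendsto_intros) (simp add: inverse_eq_divide)
  ultimately have "h l \<le> m + 0"
    using s(2) by (intro LIMSEQ_le[of "\<lambda>k. h (s k)"]) (auto intro!: exI[of _ 0] less_imp_le)
  then have "minimizer h X l" using mle \<open>l \<in> X\<close> by (fastforce simp: minimizer_def)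
  then show ?thesis using that by (simp add: h_def)
qed

section \<open>Stability of minimizers and the leaders' regret\<close>

lemma surr_diff:
  "surr n \<beta> g c x - surr n \<beta> g c z
    = ip n g (vdiff x z) * (1 + \<beta> * ip n g (vdiff x c)) - \<beta> / 2 * (ip n g (vdiff x z))\<^sup>2"
  unfolding surr_def ip_vdiff by (simp add: power2_eq_square field_simps)

text \<open>The growth inequalities at the two minimizers are added. Their objectives differ by the
  surrogates of \<open>S\<close>, whose gradients at \<open>x\<close> are multiples of
  \<open>g \<tau>\<close> by at most 9/8 = 1 + 1/8 in absolute value.\<close>

lemma stability:
  assumes X: "convex_vset X"
    and xmin: "minimizer (reg_obj n \<beta> g c A e) X x"
    and zmin: "minimizer (reg_obj n \<beta> g c (A \<union> S) e) X z"
    and fin: "finite A" "finite S" "A \<inter> S = {}"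
    and small: "\<And>\<tau>. \<tau> \<in> S \<Longrightarrow> \<bar>\<beta> * ip n (g \<tau>) (vdiff x (c \<tau>))\<bar> \<le> 1 / 8"
  shows "qform n \<beta> g (A \<union> S) e (vdiff x z) \<le> 9 / 8 * (\<Sum>\<tau>\<in>S. \<bar>ip n (g \<tau>) (vdiff x z)\<bar>)"
proof -
  define w where "w = vdiff x z"
  have mem: "x \<in> X" "z \<in> X" using xmin zmin by (auto simp: minimizer_def)
  have split: "reg_obj n \<beta> g c (A \<union> S) e y
      = reg_obj n \<beta> g c A e y + (\<Sum>\<tau>\<in>S. surr n \<beta> (g \<tau>) (c \<tau>) y)" for y
    using fin by (simp add: reg_obj_def sum.union_disjoint)
  have qsplit: "qform n \<beta> g (A \<union> S) e w = qform n \<beta> g A e w + \<beta> * (\<Sum>\<tau>\<in>S. (ip n (g \<tau>) w)\<^sup>2)"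
    using fin by (simp add: qform_def sum.union_disjoint algebra_simps)
  have "qform n \<beta> g A e w / 2 + qform n \<beta> g (A \<union> S) e w / 2
      \<le> (\<Sum>\<tau>\<in>S. surr n \<beta> (g \<tau>) (c \<tau>) x) - (\<Sum>\<tau>\<in>S. surr n \<beta> (g \<tau>) (c \<tau>) z)"
    using minimizer_growth[OF X xmin mem(2)] minimizer_growth[OF X zmin mem(1)]
    unfolding split w_def by (simp add: qform_vdiff_swap[of n \<beta> g A e z x])
  also have "\<dots> = (\<Sum>\<tau>\<in>S. ip n (g \<tau>) w * (1 + \<beta> * ip n (g \<tau>) (vdiff x (c \<tau>))))
      - \<beta> / 2 * (\<Sum>\<tau>\<in>S. (ip n (g \<tau>) w)\<^sup>2)"
    unfolding sum_subtractf[symmetric] surr_diff w_def sum_distrib_left ..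
  \<comment> \<open>The negative quadratic terms of \<open>surr_diff\<close> move to the left and
    supply exactly the curvature of \<open>S\<close> that half of the left side lacks.\<close>
  finally have "qform n \<beta> g (A \<union> S) e w
      \<le> (\<Sum>\<tau>\<in>S. ip n (g \<tau>) w * (1 + \<beta> * ip n (g \<tau>) (vdiff x (c \<tau>))))"
    unfolding qsplit by (simp add: field_simps)
  also have "\<dots> \<le> (\<Sum>\<tau>\<in>S. \<bar>ip n (g \<tau>) w\<bar> * (9 / 8))"
  proof (intro sum_mono)
    fix \<tau> assume "\<tau> \<in> S"
    define b where "b = 1 + \<beta> * ip n (g \<tau>) (vdiff x (c \<tau>))"
    have "\<bar>b\<bar> \<le> 9 / 8" using small[OF \<open>\<tau> \<in> S\<close>] unfolding b_def by linarith
    have "ip n (g \<tau>) w * b \<le> \<bar>ip n (g \<tau>) w\<bar> * \<bar>b\<bar>"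
      by (metis abs_ge_self abs_mult)
    also have "\<dots> \<le> \<bar>ip n (g \<tau>) w\<bar> * (9 / 8)"
      using \<open>\<bar>b\<bar> \<le> 9 / 8\<close> by (intro mult_left_mono) auto
    finally show "ip n (g \<tau>) w * (1 + \<beta> * ip n (g \<tau>) (vdiff x (c \<tau>))) \<le> \<bar>ip n (g \<tau>) w\<bar> * (9 / 8)"
      by (simp add: b_def)
  qed
  finally show ?thesis by (simp only: w_def sum_distrib_right[symmetric] mult.commute)
qed

text \<open>With \<open>r \<tau>\<close> bounding the dual norm of a gradient and \<open>W\<close>
  the length of the displacement, stability reads
  \<open>W * W \<le> 9 / 8 * (\<Sum>\<tau>\<in>S. r \<tau> * W)\<close>. Cancelling \<open>W\<close>
  bounds the displacement, and one more Cauchy-Schwarz bounds \<open>a t\<close>.\<close>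

lemma stability_dual:
  assumes stab: "Q \<le> 9 / 8 * (\<Sum>\<tau>\<in>S. \<bar>a \<tau>\<bar>)"
    and "finite S" and "t \<in> S" and Q: "Q \<ge> 0"
    and r: "\<And>\<tau>. \<tau> \<in> S \<Longrightarrow> r \<tau> \<ge> 0" "\<And>\<tau>. \<tau> \<in> S \<Longrightarrow> (a \<tau>)\<^sup>2 \<le> (r \<tau>)\<^sup>2 * Q"
  shows "\<bar>a t\<bar> \<le> 9 / 8 * (\<Sum>\<tau>\<in>S. r t * (r \<tau> :: real))"
proof -
  define W where "W = sqrt Q"
  have W: "W \<ge> 0" "W\<^sup>2 = Q" using Q by (auto simp: W_def)
  have aW: "\<bar>a \<tau>\<bar> \<le> r \<tau> * W" if "\<tau> \<in> S" for \<tau>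
  proof (rule power2_le_imp_le)
    show "\<bar>a \<tau>\<bar>\<^sup>2 \<le> (r \<tau> * W)\<^sup>2" using r(2)[OF that] W by (simp add: power_mult_distrib)
    show "0 \<le> r \<tau> * W" using r(1)[OF that] W by simp
  qed
  have sumr: "0 \<le> (\<Sum>\<tau>\<in>S. r \<tau>)" by (intro sum_nonneg r)
  have "W * W \<le> 9 / 8 * (\<Sum>\<tau>\<in>S. \<bar>a \<tau>\<bar>)" using stab W by (simp add: power2_eq_square)
  also have "\<dots> \<le> 9 / 8 * (\<Sum>\<tau>\<in>S. r \<tau> * W)" by (intro mult_left_mono sum_mono aW) auto
  also have "\<dots> = W * (9 / 8 * (\<Sum>\<tau>\<in>S. r \<tau>))" by (simp add: sum_distrib_left sum_distrib_right mult_ac)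
  finally have "W \<le> 9 / 8 * (\<Sum>\<tau>\<in>S. r \<tau>)"
    using W sumr by (cases "W = 0") auto
  then have "r t * W \<le> r t * (9 / 8 * (\<Sum>\<tau>\<in>S. r \<tau>))" using r(1)[OF \<open>t \<in> S\<close>] by (rule mult_left_mono)
  then have "\<bar>a t\<bar> \<le> 9 / 8 * (r t * (\<Sum>\<tau>\<in>S. r \<tau>))" using aW[OF \<open>t \<in> S\<close>] by linarith
  then show ?thesis by (simp only: sum_distrib_left)
qed

text \<open>Each leader is compared with the next one on its own objective. Raising the regularizer
  from one round to the next only increases the value, so just the last regularizer remains,
  evaluated at \<open>u\<close>.\<close>

lemma be_the_leader:
  assumes "\<And>t. t \<le> T \<Longrightarrow> minimizer (reg_obj n \<beta> g c {1..t} (\<eta> (t - 1))) X (y t)"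
    and "\<And>s t. s \<le> t \<Longrightarrow> t \<le> T \<Longrightarrow> \<eta> s \<le> \<eta> t" and "\<eta> 0 \<ge> 0" and "u \<in> X" and "t \<le> T"
  shows "(\<Sum>s=1..t. surr n \<beta> (g s) (c s) (y s)) \<le> reg_obj n \<beta> g c {1..t} (\<eta> (t - 1)) u"
proof -
  have "(\<Sum>s=1..t. surr n \<beta> (g s) (c s) (y s)) \<le> reg_obj n \<beta> g c {1..t} (\<eta> (t - 1)) (y t)"
    using \<open>t \<le> T\<close>
  proof (induction t)
    \<comment> \<open>Truncated subtraction gives the empty objective the weight
      \<open>\<eta> 0\<close>.\<close>
    case 0
    then show ?case using assms(3) by (simp add: reg_obj_def)
  next
    case (Suc t)
    have "reg_obj n \<beta> g c {1..t} (\<eta> (t - 1)) (y t) \<le> reg_obj n \<beta> g c {1..t} (\<eta> (t - 1)) (y (Suc t))"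
      using assms(1)[of t] assms(1)[of "Suc t"] Suc.prems by (auto simp: minimizer_def)
    also have "\<dots> \<le> reg_obj n \<beta> g c {1..t} (\<eta> t) (y (Suc t))"
      unfolding reg_obj_def using assms(2)[of "t - 1" t] Suc.prems
      by (intro add_left_mono mult_right_mono divide_right_mono) auto
    finally show ?case using Suc by (simp add: reg_obj_def)
  qed
  also have "\<dots> \<le> reg_obj n \<beta> g c {1..t} (\<eta> (t - 1)) u"
    using assms(1,4,5) by (auto simp: minimizer_def)
  finally show ?thesis .
qed

section \<open>Exp-concave losses\<close>

lemma ip_cauchy_schwarz: "(ip n x y)\<^sup>2 \<le> ip n x x * ip n y y"
  unfolding ip_def using Cauchy_Schwarz_ineq_sum[of x y "{..<n}"]
  by (simp add: power2_eq_square)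

lemma nrm_nonneg: "0 \<le> nrm n x"
  by (simp add: nrm_def ip_nonneg)

lemma abs_ip_le: "\<bar>ip n x y\<bar> \<le> nrm n x * nrm n y"
  unfolding nrm_def real_sqrt_mult[symmetric]
  using ip_cauchy_schwarz by (intro real_le_rsqrt) simp

lemma abs_ip_le_bound: "nrm n x \<le> a \<Longrightarrow> nrm n y \<le> b \<Longrightarrow> \<bar>ip n x y\<bar> \<le> a * b"
  using abs_ip_le[of n x y] mult_mono[of "nrm n x" a "nrm n y" b]
    nrm_nonneg[of n x] nrm_nonneg[of n y] by linarith

lemma has_grad_line:
  assumes g: "has_grad n h g y" and yu: "y \<in> vec n" "u \<in> vec n"
  shows "((\<lambda>a. h (comb a u y)) has_real_derivative ip n g (vdiff u y)) (at 0)"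
  unfolding DERIV_def
proof (rule LIM_I)
  fix r :: real assume r: "r > 0"
  define N where "N = nrm n (vdiff u y)"
  have N: "N \<ge> 0" by (simp add: N_def nrm_nonneg)
  \<comment> \<open>The tolerance is divided by \<open>N + 1\<close> rather than \<open>N\<close> to
    cover the case of a segment of length zero.\<close>
  obtain \<delta> where \<delta>: "\<delta> > 0" "\<And>z. z \<in> vec n \<Longrightarrow> nrm n (vdiff z y) < \<delta> \<Longrightarrow>
      \<bar>h z - h y - ip n g (vdiff z y)\<bar> \<le> r / (N + 1) * nrm n (vdiff z y)"
    using g r N unfolding has_grad_def by (metis add_nonneg_pos divide_pos_pos zero_less_one)
  have "norm ((h (comb (0 + a) u y) - h (comb 0 u y)) / a - ip n g (vdiff u y)) < r"
    if a: "a \<noteq> 0" "norm (a - 0) < \<delta> / (N + 1)" for a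
  proof -
    have sc: "vdiff (comb a u y) y = (\<lambda>i. a * vdiff u y i)"
      by (auto simp: vdiff_def comb_def algebra_simps)
    have ip_sc: "ip n g (vdiff (comb a u y) y) = a * ip n g (vdiff u y)"
      by (simp add: sc ip_def sum_distrib_left mult_ac)
    have "ip n (vdiff (comb a u y) y) (vdiff (comb a u y) y) = a\<^sup>2 * ip n (vdiff u y) (vdiff u y)"
      by (simp add: sc ip_def sum_distrib_left power2_eq_square mult_ac)
    then have nrm_sc: "nrm n (vdiff (comb a u y) y) = \<bar>a\<bar> * N"
      by (simp add: nrm_def N_def real_sqrt_mult)
    have "\<bar>a\<bar> * N \<le> \<bar>a\<bar> * (N + 1)" by (intro mult_left_mono) auto
    also have "\<dots> < \<delta>" using a N by (simp add: pos_less_divide_eq)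
    finally have "nrm n (vdiff (comb a u y) y) < \<delta>" by (simp add: nrm_sc)
    moreover have "comb a u y \<in> vec n" using yu by (auto simp: vec_def comb_def)
    ultimately have "\<bar>h (comb a u y) - h y - a * ip n g (vdiff u y)\<bar> \<le> r / (N + 1) * (\<bar>a\<bar> * N)"
      using \<delta>(2)[of "comb a u y"] by (simp add: nrm_sc ip_sc)
    also have "\<dots> < r * \<bar>a\<bar>" using r a N by (simp add: field_simps)
    finally have "\<bar>h (comb a u y) - h y - a * ip n g (vdiff u y)\<bar> / \<bar>a\<bar> < r"
      using a by (simp add: pos_divide_less_eq)
    moreover have "comb 0 u y = y" by (simp add: comb_def)
    moreover have "(h (comb a u y) - h y) / a - ip n g (vdiff u y)
        = (h (comb a u y) - h y - a * ip n g (vdiff u y)) / a" using a by (simp add: field_simps)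
    ultimately show ?thesis by (simp add: abs_divide)
  qed
  then show "\<exists>s>0. \<forall>a. a \<noteq> 0 \<and> norm (a - 0) < s \<longrightarrow>
      norm ((h (comb (0 + a) u y) - h (comb 0 u y)) / a - ip n g (vdiff u y)) < r"
    using \<delta>(1) N by (intro exI[of _ "\<delta> / (N + 1)"]) auto
qed

text \<open>A concave function on the segment lies below its tangent at \<open>y\<close>; dividing
  by the positive value there leaves only the difference of losses in the exponent.\<close>

lemma exp_concave_first_order:
  assumes X: "X \<subseteq> vec n" "y \<in> X" "u \<in> X"
    and g: "has_grad n h g y" and conc: "concave_fn X (\<lambda>z. exp (- \<alpha> * h z))"
  shows "exp (\<alpha> * (h y - h u)) \<le> 1 - \<alpha> * ip n g (vdiff u y)"
proof -
  define \<phi> where "\<phi> a = exp (- \<alpha> * h (comb a u y))" for a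
  have ends: "comb 0 u y = y" "comb 1 u y = u" by (auto simp: comb_def)
  have "((\<lambda>a. h (comb a u y)) has_real_derivative ip n g (vdiff u y)) (at 0)"
    using has_grad_line[OF g] X by blast
  then have "(\<phi> has_real_derivative - \<alpha> * ip n g (vdiff u y) * \<phi> 0) (at 0)"
    unfolding \<phi>_def by (auto intro!: derivative_eq_intros)
  then have "((\<lambda>a. (\<phi> a - \<phi> 0) / a) \<longlongrightarrow> - \<alpha> * ip n g (vdiff u y) * \<phi> 0) (at_right 0)"
    unfolding DERIV_def by (simp add: filterlim_at_split)
  moreover have "eventually (\<lambda>a. \<phi> 1 - \<phi> 0 \<le> (\<phi> a - \<phi> 0) / a) (at_right 0)"
  proof -
    have "\<phi> 1 - \<phi> 0 \<le> (\<phi> a - \<phi> 0) / a" if "0 < a" "a < 1" for a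
    proof -
      have "- \<phi> a \<le> a * - \<phi> 1 + (1 - a) * - \<phi> 0"
        using conc X(2,3) that unfolding concave_fn_def convex_fn_def \<phi>_def ends by force
      then show ?thesis using that by (simp add: field_simps)
    qed
    then show ?thesis by (auto simp: eventually_at_right_field intro!: exI[of _ 1])
  qed
  ultimately have "\<phi> 1 - \<phi> 0 \<le> - \<alpha> * ip n g (vdiff u y) * \<phi> 0"
    by (intro tendsto_lowerbound) auto
  then have "\<phi> 1 / \<phi> 0 \<le> 1 - \<alpha> * ip n g (vdiff u y)"
    by (subst divide_le_eq) (simp add: \<phi>_def algebra_simps)
  moreover have "\<phi> 1 / \<phi> 0 = exp (\<alpha> * (h y - h u))"
    by (simp add: \<phi>_def ends exp_diff[symmetric] algebra_simps)
  ultimately show ?thesis by simp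
qed

text \<open>With \<open>4 * s = v - v\<^sup>2 / 4\<close>, the bound
  \<open>exp (4 * s) \<ge> 1 + 4 * s\<close> is too weak, but
  \<open>exp s ^ 4 \<ge> (1 + s) ^ 4\<close> adds a term \<open>6 * s\<^sup>2\<close> of about 3/8
  times the square of \<open>v\<close>, enough to cover the missing quarter.\<close>

lemma ln_one_plus_le_quadratic:
  fixes v :: real
  assumes "\<bar>v\<bar> \<le> 1 / 4"
  shows "ln (1 + v) \<le> v - v\<^sup>2 / 4"
proof -
  define s where "s = v * (4 - v) / 16"
  have "\<bar>v * (4 - v)\<bar> \<le> 1 / 4 * (17 / 4)"
    unfolding abs_mult using assms by (intro mult_mono) auto
  then have s: "\<bar>s\<bar> \<le> 17 / 256" by (simp add: s_def)
  have "(15 / 4)\<^sup>2 \<le> (4 - v)\<^sup>2" using assms by (intro power_mono) auto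
  \<comment> \<open>The product on the left exceeds 64, which is all the next step uses.\<close>
  then have "5 * (225 / 16) \<le> (6 + 4 * s) * (4 - v)\<^sup>2"
    using s by (intro mult_mono) (auto simp: power2_eq_square)
  then have "v\<^sup>2 / 256 * 64 \<le> v\<^sup>2 / 256 * ((6 + 4 * s) * (4 - v)\<^sup>2)"
    by (intro mult_left_mono) auto
  also have "\<dots> = (6 + 4 * s) * s\<^sup>2" by (simp add: s_def power_mult_distrib power_divide)
  finally have "v\<^sup>2 / 4 \<le> (6 + 4 * s) * s\<^sup>2" by simp
  moreover have "(1 + s) ^ 4 = 1 + 4 * s + (6 + 4 * s) * s\<^sup>2 + s ^ 4" by algebra
  moreover have "4 * s = v - v\<^sup>2 / 4" by (simp add: s_def power2_eq_square field_simps)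
  moreover have "0 \<le> s ^ 4" by simp
  ultimately have "1 + v \<le> (1 + s) ^ 4" by linarith
  also have "\<dots> \<le> exp s ^ 4" using s by (intro power_mono exp_ge_add_one_self) auto
  also have "\<dots> = exp (v - v\<^sup>2 / 4)"
    using \<open>4 * s = v - v\<^sup>2 / 4\<close> by (simp flip: exp_of_nat_mult)
  finally have "ln (1 + v) \<le> ln (exp (v - v\<^sup>2 / 4))"
    using assms by (subst ln_le_cancel_iff) auto
  then show ?thesis by simp
qed

lemma exp_concave_surrogate:
  assumes X: "X \<subseteq> vec n" "y \<in> X" "u \<in> X"
    and g: "has_grad n h g y" and conc: "concave_fn X (\<lambda>z. exp (- \<alpha> * h z))"
    and \<beta>: "0 < \<beta>" "2 * \<beta> \<le> \<alpha>" and small: "\<bar>\<beta> * ip n g (vdiff u y)\<bar> \<le> 1 / 8"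
  shows "h y - h u \<le> surr n \<beta> g y y - surr n \<beta> g y u"
proof -
  define z where "z = ip n g (vdiff u y)"
  define \<Delta> where "\<Delta> = h y - h u"
  have \<alpha>: "\<alpha> > 0" using \<beta> by simp
  \<comment> \<open>Convexity of \<open>exp\<close> between 0 and \<open>\<alpha> * \<Delta>\<close>
    carries the first-order inequality from parameter \<alpha> down to
    \<open>2 * \<beta>\<close>.\<close>
  define p where "p = 2 * \<beta> / \<alpha>"
  have p: "0 \<le> p" "p \<le> 1" "p * \<alpha> = 2 * \<beta>" using \<beta> \<alpha> by (auto simp: p_def)
  have "exp (2 * \<beta> * \<Delta>) = exp ((1 - p) *\<^sub>R 0 + p *\<^sub>R (\<alpha> * \<Delta>))"
    by (simp add: mult.assoc[symmetric] p(3))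
  also have "\<dots> \<le> (1 - p) * exp 0 + p * exp (\<alpha> * \<Delta>)"
    by (intro convex_onD[OF exp_convex] p) auto
  also have "\<dots> \<le> (1 - p) * exp 0 + p * (1 - \<alpha> * z)"
    using exp_concave_first_order[OF X g conc] p
    by (intro add_left_mono mult_left_mono) (auto simp: \<Delta>_def z_def)
  also have "\<dots> = 1 - p * \<alpha> * z" by (simp add: algebra_simps)
  finally have "exp (2 * \<beta> * \<Delta>) \<le> 1 + (- 2 * \<beta> * z)" by (simp add: p(3))
  then have "2 * \<beta> * \<Delta> \<le> ln (1 + (- 2 * \<beta> * z))"
    using less_le_trans[OF exp_gt_zero] by (subst ln_ge_iff)
  also have "\<dots> \<le> (- 2 * \<beta> * z) - (- 2 * \<beta> * z)\<^sup>2 / 4"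
    using small by (intro ln_one_plus_le_quadratic) (auto simp: z_def abs_mult)
  also have "\<dots> = 2 * \<beta> * (- z - \<beta> / 2 * z\<^sup>2)" by (simp add: power2_eq_square algebra_simps)
  finally have "\<Delta> \<le> - z - \<beta> / 2 * z\<^sup>2" using \<beta>(1) by simp
  moreover have "ip n g (vdiff y y) = 0" by (simp add: ip_vdiff)
  ultimately show ?thesis unfolding surr_def \<Delta>_def z_def by (simp add: ip_vdiff)
qed

section \<open>Missing rounds and the cost of the first round\<close>

lemma finite_obs: "finite (obs d t)"
  by (rule finite_subset[of _ "{..<t}"]) (auto simp: obs_def)

lemma finite_miss: "finite (miss d t)"
  by (simp add: miss_def)

lemma rounds_split: "t \<ge> 1 \<Longrightarrow> {1..t} = obs d t \<union> insert t (miss d t)"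
  "obs d t \<inter> insert t (miss d t) = {}"
  by (auto simp: obs_def miss_def)

text \<open>Double counting with two windows of length \<open>m\<close>: the rounds missing at
  \<open>t\<close> lie in the \<open>m\<close> rounds before it, and the rounds at which \<tau> is
  missing lie in the \<open>m\<close> rounds after it.\<close>

lemma miss_pair_sum:
  fixes p :: "nat \<Rightarrow> real"
  assumes d: "\<And>t. t \<in> {1..T} \<Longrightarrow> d t \<le> m" and p: "\<And>t. p t \<ge> 0"
  shows "(\<Sum>t=1..T. \<Sum>\<tau>\<in>miss d t. (p t + p \<tau>) / 2) \<le> real m * (\<Sum>t=1..T. p t)"
proof -
  have "card (miss d t) \<le> m" if "t \<in> {1..T}" for t
  proof -
    have "\<tau> \<in> {t - m..<t}" if "\<tau> \<in> miss d t" for \<tau>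
      using that \<open>t \<in> {1..T}\<close> d[of \<tau>] by (auto simp: miss_def obs_def)
    then have "miss d t \<subseteq> {t - m..<t}" by blast
    from card_mono[OF _ this] have "card (miss d t) \<le> t - (t - m)" by simp
    then show ?thesis by arith
  qed
  then have "(\<Sum>t=1..T. \<Sum>\<tau>\<in>miss d t. p t) \<le> (\<Sum>t=1..T. m * p t)"
    using p by (intro sum_mono) (auto intro: mult_right_mono)
  then have 1: "(\<Sum>t=1..T. \<Sum>\<tau>\<in>miss d t. p t) \<le> m * (\<Sum>t=1..T. p t)"
    by (simp add: sum_distrib_left)
  have "miss d t = {\<tau>\<in>{1..T}. \<tau> \<in> miss d t}" if "t \<in> {1..T}" for t
    using that by (auto simp: miss_def)
  then have "(\<Sum>t=1..T. \<Sum>\<tau>\<in>miss d t. p \<tau>) = (\<Sum>t=1..T. \<Sum>\<tau>\<in>{\<tau>\<in>{1..T}. \<tau> \<in> miss d t}. p \<tau>)"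
    by (intro sum.cong) auto
  also have "\<dots> = (\<Sum>\<tau>=1..T. \<Sum>t\<in>{t\<in>{1..T}. \<tau> \<in> miss d t}. p \<tau>)"
    by (rule sum.swap_restrict) auto
  also have "\<dots> \<le> (\<Sum>\<tau>=1..T. m * p \<tau>)"
  proof (intro sum_mono)
    fix \<tau> assume "\<tau> \<in> {1..T}"
    then have "{t\<in>{1..T}. \<tau> \<in> miss d t} \<subseteq> {\<tau><..\<tau> + m}"
      using d[of \<tau>] by (auto simp: miss_def obs_def)
    from card_mono[OF _ this] have "card {t\<in>{1..T}. \<tau> \<in> miss d t} \<le> m" by simp
    then show "(\<Sum>t\<in>{t\<in>{1..T}. \<tau> \<in> miss d t}. p \<tau>) \<le> m * p \<tau>"
      using p[of \<tau>] by (simp add: mult_right_mono)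
  qed
  finally have 2: "(\<Sum>t=1..T. \<Sum>\<tau>\<in>miss d t. p \<tau>) \<le> m * (\<Sum>t=1..T. p t)"
    by (simp add: sum_distrib_left)
  have "(\<Sum>t=1..T. \<Sum>\<tau>\<in>miss d t. (p t + p \<tau>) / 2)
      = ((\<Sum>t=1..T. \<Sum>\<tau>\<in>miss d t. p t) + (\<Sum>t=1..T. \<Sum>\<tau>\<in>miss d t. p \<tau>)) / 2"
    by (simp only: sum.distrib sum_divide_distrib[symmetric])
  then show ?thesis using 1 2 by simp
qed

text \<open>The first iterate is arbitrary, so stability says nothing about round 1; its cost \<open>G * D\<close> is
  absorbed by AM-GM into the regularizer when the logarithm is small, and by \<open>8 * \<beta> * G * D \<le> 1\<close> otherwise.\<close>

lemma first_round_cost: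
  fixes G D \<beta> e :: real
  assumes pos: "n \<ge> 1" "T \<ge> 1" "G > 0" "D > 0" "\<beta> > 0" "e > 0" and small: "8 * \<beta> * G * D \<le> 1"
  shows "G * D \<le> real n / \<beta> * ln (1 + \<beta> * G\<^sup>2 * real T / (e * real n)) + e * D\<^sup>2"
proof -
  define a where "a = \<beta> * G\<^sup>2 * real T / (e * real n)"
  have a: "a > 0" using pos by (simp add: a_def)
  have "ln (1 / (1 + a)) \<le> 1 / (1 + a) - 1" using a by (intro ln_le_minus_one) simp
  then have L: "a / (1 + a) \<le> ln (1 + a)" using a by (simp add: ln_div field_simps)
  have "G * D \<le> real n / \<beta> * (a / (1 + a)) + e * D\<^sup>2"
  \<comment> \<open>For \<open>a \<le> 1\<close> the fraction is at least \<open>a / 2\<close>, and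
    \<open>real n / \<beta> * (a / 2)\<close> is precisely \<open>G\<^sup>2 * T / (2 * e)\<close>.
    Otherwise it is at least 1/2, and \<open>G * D\<close> is at most
    \<open>1 / (8 * \<beta>)\<close>.\<close>
  proof (cases "a \<le> 1")
    case True
    have "G\<^sup>2 / (2 * e) \<le> G\<^sup>2 * T / (2 * e)" using pos by (intro divide_right_mono) auto
    also have "\<dots> = real n / \<beta> * (a / 2)" using pos by (simp add: a_def)
    also have "\<dots> \<le> real n / \<beta> * (a / (1 + a))"
      using True a pos by (intro mult_left_mono divide_left_mono) auto
    finally have 1: "G\<^sup>2 / (2 * e) \<le> real n / \<beta> * (a / (1 + a))" .
    have "0 \<le> (G - e * D)\<^sup>2 / (2 * e)" using pos by simp
    also have "\<dots> = G\<^sup>2 / (2 * e) - G * D + e * D\<^sup>2 / 2"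
      using pos by (simp add: power2_eq_square field_simps)
    also have "\<dots> \<le> G\<^sup>2 / (2 * e) - G * D + e * D\<^sup>2" using pos by simp
    finally show ?thesis using 1 by simp
  next
    case False
    have "G * D \<le> 1 / \<beta> * (1 / 2)" using small pos by (simp add: field_simps)
    also have "\<dots> \<le> real n / \<beta> * (a / (1 + a))"
      using False pos by (intro mult_mono divide_right_mono) (auto simp: field_simps)
    finally show ?thesis using pos by (simp add: add_increasing2)
  qed
  also have "\<dots> \<le> real n / \<beta> * ln (1 + a) + e * D\<^sup>2"
    using L pos by (intro add_right_mono mult_left_mono) auto
  finally show ?thesis by (simp add: a_def)
qed

section \<open>Regret of delayed online Newton step\<close>

lemma scaled_le_eighth:
  fixes \<beta> G D z :: real
  assumes "\<beta> > 0" "8 * \<beta> * G * D \<le> 1" "\<bar>z\<bar> \<le> G * D"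
  shows "\<bar>\<beta> * z\<bar> \<le> 1 / 8"
proof -
  have "\<bar>\<beta> * z\<bar> = \<beta> * \<bar>z\<bar>" using assms(1) by (simp add: abs_mult)
  also have "\<dots> \<le> \<beta> * (G * D)" using assms by (intro mult_left_mono) auto
  also have "\<dots> \<le> 1 / 8" using assms(2) by (simp add: mult.assoc)
  finally show ?thesis .
qed

text \<open>The losses are gone: only gradients, surrogates and delays bounded by \<open>m\<close>
  remain. The first entry of the minimum is the \<open>1 / \<beta>\<close> part of B_1.\<close>

lemma surrogate_regret:
  fixes g x :: "nat \<Rightarrow> nat \<Rightarrow> real" and \<eta> :: "nat \<Rightarrow> real" and m :: nat
  assumes n: "n \<ge> 1" and T: "T \<ge> 1"
    and X: "X \<subseteq> vec n" "closed_vset n X" "convex_vset X" "(\<lambda>i. 0) \<in> X"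
    and D: "D > 0" "\<And>y z. y \<in> X \<Longrightarrow> z \<in> X \<Longrightarrow> nrm n (vdiff y z) \<le> D"
    and G: "G > 0" "\<And>t. t \<in> {1..T} \<Longrightarrow> nrm n (g t) \<le> G"
    and \<beta>: "\<beta> > 0" "8 * \<beta> * G * D \<le> 1"
    and \<eta>: "\<eta> 0 > 0" "\<And>s t. s \<le> t \<Longrightarrow> t \<le> T \<Longrightarrow> \<eta> s \<le> \<eta> t"
    and d: "\<And>t. t \<in> {1..T} \<Longrightarrow> d t \<le> m"
    and x1: "x 1 \<in> X"
    and xmin: "\<And>t. 1 < t \<Longrightarrow> t \<le> T \<Longrightarrow> minimizer (reg_obj n \<beta> g x (obs d t) (\<eta> (t - 1))) X (x t)"
    and u: "u \<in> X"
    and L: "L = ln (1 + \<beta> * G\<^sup>2 * real T / (\<eta> 0 * real n))"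
    and B: "B = G\<^sup>2 * (\<Sum>t=1..T. real (card (miss d t)) / \<eta> (t - 1))"
  shows "(\<Sum>t=1..T. surr n \<beta> (g t) (x t) (x t) - surr n \<beta> (g t) (x t) u)
    \<le> 3 * (n / \<beta> * L + \<eta> T * D\<^sup>2 + min (n / \<beta> * L * m) B)"
proof -
  have xX: "x t \<in> X" if "t \<in> {1..T}" for t
    using that x1 xmin[of t] by (cases "t = 1") (auto simp: minimizer_def)
  have \<eta>pos: "\<eta> t > 0" if "t \<le> T" for t using \<eta>(1) \<eta>(2)[of 0 t] that by simp
  have ipG: "ip n (g t) (g t) \<le> G\<^sup>2" if "t \<in> {1..T}" for t
    using power_mono[OF G(2)[OF that] nrm_nonneg, of 2] by (simp add: nrm_sq)
  obtain p where p: "\<And>t. 0 \<le> p t"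
    "\<And>t w. t \<ge> 1 \<Longrightarrow> (ip n (g t) w)\<^sup>2 \<le> p t * qform n \<beta> g {1..t} (\<eta> 0) w"
    "(\<Sum>t=1..T. p t) \<le> n / \<beta> * L"
    using elliptical_potential[where g = g, OF n \<beta>(1) \<eta>(1) ipG] unfolding L by blast
  have "\<exists>y. t \<le> T \<longrightarrow> minimizer (reg_obj n \<beta> g x {1..t} (\<eta> (t - 1))) X y" for t
    using minimizer_exists[OF X(1) _ X(2,3) \<beta>(1) \<eta>pos[of "t - 1"]] X(4)
    by (metis empty_iff diff_le_self le_trans)
  then obtain y where y: "\<And>t. t \<le> T \<Longrightarrow> minimizer (reg_obj n \<beta> g x {1..t} (\<eta> (t - 1))) X (y t)"
    by metis
  have yX: "y t \<in> X" if "t \<le> T" for t using y[OF that] by (simp add: minimizer_def)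
  \<comment> \<open>The charge for a pair of rounds; summing its first argument gives
    \<open>B\<close>, summing its second gives the logarithmic bound.\<close>
  define c where "c t \<tau> = min (G\<^sup>2 / \<eta> (t - 1)) ((p t + p \<tau>) / 2)" for t \<tau>
  have c: "c t \<tau> \<ge> 0" if "t \<le> T" for t \<tau>
    using p(1) \<eta>pos[of "t - 1"] that by (simp add: c_def less_imp_le)
  have move: "ip n (g t) (vdiff (x t) (y t)) \<le> 9 / 8 * (p t + (\<Sum>\<tau>\<in>miss d t. c t \<tau>))"
    if t: "1 < t" "t \<le> T" for t
  proof -
    define e where "e = \<eta> (t - 1)"
    define w where "w = vdiff (x t) (y t)"
    define S where "S = insert t (miss d t)"
    define Q where "Q = qform n \<beta> g {1..t} e w"
    \<comment> \<open>Two bounds on the same dual norm: one from the potential, one from the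
      regularizer alone.\<close>
    define r where "r \<tau> = sqrt (min (p \<tau>) (G\<^sup>2 / e))" for \<tau>
    have e: "e > 0" "\<eta> 0 \<le> e" using \<eta>pos[of "t - 1"] \<eta>(2)[of 0 "t - 1"] t by (auto simp: e_def)
    have S: "finite S" "t \<in> S" "\<And>\<tau>. \<tau> \<in> S \<Longrightarrow> \<tau> \<in> {1..t}" using t by (auto simp: S_def finite_miss miss_def)
    have split: "{1..t} = obs d t \<union> S" "obs d t \<inter> S = {}"
      using rounds_split(1)[of t d] rounds_split(2)[of d t] t by (auto simp: S_def)
    have "Q \<le> 9 / 8 * (\<Sum>\<tau>\<in>S. \<bar>ip n (g \<tau>) w\<bar>)"
      unfolding Q_def w_def split(1)
    proof (rule stability[OF X(3) _ _ finite_obs S(1) split(2)])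
      show "minimizer (reg_obj n \<beta> g x (obs d t) e) X (x t)" using xmin[OF t] by (simp add: e_def)
      show "minimizer (reg_obj n \<beta> g x (obs d t \<union> S) e) X (y t)"
        using y[OF t(2)] unfolding split(1) e_def .
      fix \<tau> assume "\<tau> \<in> S"
      then have \<tau>: "\<tau> \<in> {1..T}" using S(3)[of \<tau>] t by auto
      have "\<bar>ip n (g \<tau>) (vdiff (x t) (x \<tau>))\<bar> \<le> G * D"
        using G(2)[OF \<tau>] D(2)[OF xX xX[OF \<tau>], of t] t by (intro abs_ip_le_bound) auto
      then show "\<bar>\<beta> * ip n (g \<tau>) (vdiff (x t) (x \<tau>))\<bar> \<le> 1 / 8" by (rule scaled_le_eighth[OF \<beta>])
    qed
    moreover have Q0: "Q \<ge> 0" unfolding Q_def using \<beta> e by (intro qform_nonneg) auto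
    moreover have rsq: "(r \<tau>)\<^sup>2 = min (p \<tau>) (G\<^sup>2 / e)" "r \<tau> \<ge> 0" for \<tau>
      using p(1) e by (auto simp: r_def)
    moreover have "(ip n (g \<tau>) w)\<^sup>2 \<le> (r \<tau>)\<^sup>2 * Q" if "\<tau> \<in> S" for \<tau>
    proof -
      have \<tau>: "\<tau> \<in> {1..T}" "\<tau> \<in> {1..t}" using S(3)[OF that] t by auto
      have "(ip n (g \<tau>) w)\<^sup>2 \<le> p \<tau> * qform n \<beta> g {1..\<tau>} (\<eta> 0) w" using p(2) \<tau> by simp
      \<comment> \<open>The form of round \<tau> with weight \<open>\<eta> 0\<close> is dominated by
        that of round \<open>t\<close> with weight \<open>e\<close>, because the rounds are nested
        and the learning rates increase.\<close>
      also have "\<dots> \<le> p \<tau> * Q"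
        unfolding Q_def using \<beta> e \<tau> p(1) by (intro mult_left_mono qform_mono) auto
      finally have 1: "(ip n (g \<tau>) w)\<^sup>2 \<le> p \<tau> * Q" .
      have "(ip n (g \<tau>) w)\<^sup>2 \<le> ip n (g \<tau>) (g \<tau>) * ip n w w" by (rule ip_cauchy_schwarz)
      also have "\<dots> \<le> G\<^sup>2 * ip n w w" by (intro mult_right_mono ipG \<tau> ip_nonneg)
      also have "\<dots> = G\<^sup>2 / e * (e * ip n w w)" using e by simp
      also have "\<dots> \<le> G\<^sup>2 / e * Q"
        unfolding Q_def using \<beta> e by (intro mult_left_mono qform_ge) auto
      finally show ?thesis using 1 by (simp add: rsq min_def)
    qed
    ultimately have "\<bar>ip n (g t) w\<bar> \<le> 9 / 8 * (\<Sum>\<tau>\<in>S. r t * r \<tau>)"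
      by (intro stability_dual[OF _ S(1,2)]) auto
    also have "(\<Sum>\<tau>\<in>S. r t * r \<tau>) = (r t)\<^sup>2 + (\<Sum>\<tau>\<in>miss d t. r t * r \<tau>)"
      unfolding S_def by (subst sum.insert) (auto simp: finite_miss miss_def power2_eq_square)
    also have "\<dots> \<le> p t + (\<Sum>\<tau>\<in>miss d t. c t \<tau>)"
    proof (intro add_mono sum_mono)
      show "(r t)\<^sup>2 \<le> p t" by (simp add: rsq)
      fix \<tau>
      have "0 \<le> (r t - r \<tau>)\<^sup>2" by simp
      \<comment> \<open>After AM-GM on \<open>r t * r \<tau>\<close>, the average of the truncated
        potentials is at most the truncated average, which is \<open>c t \<tau>\<close>.\<close>
      have mins: "(min a k + min b k) / 2 \<le> min k ((a + b) / 2)" for a b k :: real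
        by (simp add: min_def)
      from \<open>0 \<le> (r t - r \<tau>)\<^sup>2\<close> have "r t * r \<tau> \<le> ((r t)\<^sup>2 + (r \<tau>)\<^sup>2) / 2" by (simp add: power2_diff)
      then show "r t * r \<tau> \<le> c t \<tau>" 
        using mins[of "p t" "G\<^sup>2 / e" "p \<tau>"] unfolding c_def rsq e_def[symmetric] by (rule order_trans)
    qed
    finally show ?thesis unfolding w_def by simp
  qed
  define A where "A = (\<Sum>t=1..T. p t + (\<Sum>\<tau>\<in>miss d t. c t \<tau>))"
  have "(\<Sum>t=1..T. ip n (g t) (vdiff (x t) (y t)))
      \<le> (\<Sum>t=1..T. (if t = 1 then G * D else 0) + 9 / 8 * (p t + (\<Sum>\<tau>\<in>miss d t. c t \<tau>)))"
  proof (intro sum_mono)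
    fix t assume t: "t \<in> {1..T}"
    have nonneg: "0 \<le> p t + (\<Sum>\<tau>\<in>miss d t. c t \<tau>)"
      using p(1) c t by (intro add_nonneg_nonneg sum_nonneg) auto
    have "\<bar>ip n (g t) (vdiff (x t) (y t))\<bar> \<le> G * D"
      using G(2)[OF t] D(2)[OF xX[OF t] yX, of t] t by (intro abs_ip_le_bound) auto
    then show "ip n (g t) (vdiff (x t) (y t))
        \<le> (if t = 1 then G * D else 0) + 9 / 8 * (p t + (\<Sum>\<tau>\<in>miss d t. c t \<tau>))"
    proof (cases "t = 1")
      case True
      have "ip n (g t) (vdiff (x t) (y t)) \<le> G * D"
        using \<open>\<bar>ip n (g t) (vdiff (x t) (y t))\<bar> \<le> G * D\<close> by (rule order_trans[OF abs_ge_self])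
      then have "ip n (g t) (vdiff (x t) (y t)) \<le> G * D + 9 / 8 * (p t + (\<Sum>\<tau>\<in>miss d t. c t \<tau>))"
        by (rule add_increasing2[rotated]) (rule mult_nonneg_nonneg[OF _ nonneg], simp)
      then show ?thesis by (simp only: True refl if_True)
    next
      case False
      then show ?thesis using move[of t] t by simp
    qed
  qed
  also have "\<dots> = G * D + 9 / 8 * A"
    using T by (simp add: A_def sum.distrib sum_distrib_left distrib_left)
  finally have drift: "(\<Sum>t=1..T. ip n (g t) (vdiff (x t) (y t))) \<le> G * D + 9 / 8 * A" .

  have "(\<Sum>t=1..T. \<Sum>\<tau>\<in>miss d t. c t \<tau>) \<le> (\<Sum>t=1..T. \<Sum>\<tau>\<in>miss d t. (p t + p \<tau>) / 2)"
    unfolding c_def by (intro sum_mono min.cobounded2)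
  also have "\<dots> \<le> m * (\<Sum>t=1..T. p t)" by (rule miss_pair_sum[OF d p(1)])
  also have "\<dots> \<le> m * (n / \<beta> * L)" using p(3) by (intro mult_left_mono) auto
  finally have C1: "(\<Sum>t=1..T. \<Sum>\<tau>\<in>miss d t. c t \<tau>) \<le> n / \<beta> * L * m" by (simp add: mult.commute)
  have "(\<Sum>t=1..T. \<Sum>\<tau>\<in>miss d t. c t \<tau>) \<le> (\<Sum>t=1..T. \<Sum>\<tau>\<in>miss d t. G\<^sup>2 / \<eta> (t - 1))"
    unfolding c_def by (intro sum_mono min.cobounded1)
  also have "\<dots> = B" by (simp add: B sum_distrib_left mult.commute)
  finally have "A \<le> n / \<beta> * L + min (n / \<beta> * L * m) B"
    using C1 p(3) by (simp add: A_def sum.distrib)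

  \<comment> \<open>At its own centre \<open>x t\<close> the surrogate has gradient exactly
    \<open>g t\<close>, so convexity gives the linear bound.\<close>
  have "(\<Sum>t=1..T. surr n \<beta> (g t) (x t) (x t) - surr n \<beta> (g t) (x t) (y t))
      \<le> (\<Sum>t=1..T. ip n (g t) (vdiff (x t) (y t)))"
    using \<beta> by (intro sum_mono) (simp add: surr_diff ip_vdiff)
  then have cheat: "(\<Sum>t=1..T. surr n \<beta> (g t) (x t) (x t))
      \<le> (\<Sum>t=1..T. surr n \<beta> (g t) (x t) (y t)) + G * D + 9 / 8 * A"
    using drift by (simp add: sum_subtractf)
  have "nrm n u \<le> D" using D(2)[OF u X(4)] by (simp add: vdiff_def)
  then have "\<eta> (T - 1) / 2 * (nrm n u)\<^sup>2 \<le> \<eta> T / 2 * D\<^sup>2"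
    using \<eta>(2)[of "T - 1" T] \<eta>pos[of T] nrm_nonneg by (intro mult_mono power_mono) auto
  then have btl: "(\<Sum>t=1..T. surr n \<beta> (g t) (x t) (y t))
      \<le> (\<Sum>t=1..T. surr n \<beta> (g t) (x t) u) + \<eta> T * D\<^sup>2 / 2"
    using be_the_leader[where T = T and t = T, OF y \<eta>(2) _ u] \<eta>(1) by (simp add: reg_obj_def)
  have "\<eta> 0 * D\<^sup>2 \<le> \<eta> T * D\<^sup>2" using \<eta>(2)[of 0 T] by (intro mult_right_mono) auto
  then have "G * D \<le> n / \<beta> * L + \<eta> T * D\<^sup>2"
    using first_round_cost[OF n T G(1) D(1) \<beta>(1) \<eta>(1) \<beta>(2)] unfolding L by simp
  moreover have "0 \<le> n / \<beta> * L" using sum_nonneg[of "{1..T}" p] p by simp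
  moreover have "0 \<le> \<eta> T * D\<^sup>2" using \<eta>pos[of T] by simp
  moreover have "0 \<le> min (n / \<beta> * L * m) B"
  proof -
    have "0 \<le> B" unfolding B using \<eta>pos
      by (intro mult_nonneg_nonneg sum_nonneg divide_nonneg_nonneg) (auto intro: less_imp_le)
    moreover have "0 \<le> n / \<beta> * L * m" by (rule mult_nonneg_nonneg[OF \<open>0 \<le> n / \<beta> * L\<close>]) simp
    ultimately show ?thesis by (rule min.boundedI[rotated])
  qed
  \<comment> \<open>The logarithmic term is counted 1 + 9/8 times, the regularizer 1 + 1/2 times and
    the minimum 9/8 times; 3 exceeds all three.\<close>
  ultimately show ?thesis
    using cheat btl \<open>A \<le> n / \<beta> * L + min (n / \<beta> * L * m) B\<close>
    unfolding sum_subtractf by argo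
qed

theorem theorem4p1:
  shows "\<exists>C>0. \<forall>(n::nat) (T::nat) (X::(nat\<Rightarrow>real) set) (D::real) (\<alpha>::real) (G::real)
      (f::nat \<Rightarrow> (nat\<Rightarrow>real) \<Rightarrow> real) (gr::nat \<Rightarrow> (nat\<Rightarrow>real) \<Rightarrow> (nat\<Rightarrow>real))
      (d::nat \<Rightarrow> nat) (\<eta>::nat \<Rightarrow> real) (x::nat \<Rightarrow> (nat\<Rightarrow>real)).
    n \<ge> 1 \<longrightarrow> T \<ge> 1 \<longrightarrow>
    X \<subseteq> vec n \<longrightarrow> X \<noteq> {} \<longrightarrow> closed_vset n X \<longrightarrow> convex_vset X \<longrightarrow> (\<lambda>i. 0) \<in> X \<longrightarrow>
    D > 0 \<longrightarrow> (\<forall>y\<in>X. \<forall>z\<in>X. nrm n (vdiff y z) \<le> D) \<longrightarrow>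
    \<alpha> > 0 \<longrightarrow> G > 0 \<longrightarrow>
    (\<forall>t\<in>{1..T}. convex_fn X (f t)
        \<and> (\<forall>y\<in>X. has_grad n (f t) (gr t y) y)
        \<and> concave_fn X (\<lambda>y. exp (- \<alpha> * f t y))
        \<and> (\<forall>y\<in>X. nrm n (gr t y) \<le> G)) \<longrightarrow>
    (\<forall>t\<in>{1..T}. t + d t \<le> T) \<longrightarrow>
    \<eta> 0 > 0 \<longrightarrow> (\<forall>s t. s \<le> t \<longrightarrow> t \<le> T \<longrightarrow> \<eta> s \<le> \<eta> t) \<longrightarrow>
    (let \<beta> = 1/2 * min (1 / (4 * G * D)) \<alpha>;
         g = (\<lambda>\<tau>. gr \<tau> (x \<tau>));
         L = ln (1 + \<beta> * G^2 * real T / (\<eta> 0 * real n));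
         dmax = Max (d ` {1..T});
         B1 = (G^2 / \<eta> 0 + 1 / \<beta>) * real n * real dmax * L;
         B2 = G^2 * (\<Sum>t=1..T. real (card (miss d t)) / \<eta> (t - 1))
     in x 1 \<in> X \<longrightarrow>
        (\<forall>t. 1 \<le> t \<and> t < T \<longrightarrow>
            x (t+1) \<in> X \<and> (\<forall>y\<in>X. ons_obj n \<beta> d g x (\<eta> t) t (x (t+1)) \<le> ons_obj n \<beta> d g x (\<eta> t) t y)) \<longrightarrow>
        (\<forall>u\<in>X. (\<Sum>t=1..T. f t (x t) - f t u)
            \<le> C * (real n / \<beta> * L + \<eta> T * D^2 + min B1 B2)))"
proof (intro exI[of _ "3::real"] conjI allI impI, simp)
  fix n T :: nat and X :: "(nat \<Rightarrow> real) set" and D \<alpha> G :: real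
    and f :: "nat \<Rightarrow> (nat \<Rightarrow> real) \<Rightarrow> real" and gr :: "nat \<Rightarrow> (nat \<Rightarrow> real) \<Rightarrow> (nat \<Rightarrow> real)"
    and d :: "nat \<Rightarrow> nat" and \<eta> :: "nat \<Rightarrow> real" and x :: "nat \<Rightarrow> (nat \<Rightarrow> real)"
  assume n: "n \<ge> 1" and T: "T \<ge> 1"
    and X: "X \<subseteq> vec n" "X \<noteq> {}" "closed_vset n X" "convex_vset X" "(\<lambda>i. 0) \<in> X"
    and D: "D > 0" "\<forall>y\<in>X. \<forall>z\<in>X. nrm n (vdiff y z) \<le> D"
    and pos: "\<alpha> > 0" "G > 0"
    and f: "\<forall>t\<in>{1..T}. convex_fn X (f t)
        \<and> (\<forall>y\<in>X. has_grad n (f t) (gr t y) y)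
        \<and> concave_fn X (\<lambda>y. exp (- \<alpha> * f t y))
        \<and> (\<forall>y\<in>X. nrm n (gr t y) \<le> G)"
    and \<eta>: "\<eta> 0 > 0" "\<forall>s t. s \<le> t \<longrightarrow> t \<le> T \<longrightarrow> \<eta> s \<le> \<eta> t"
  define \<beta> where "\<beta> = 1/2 * min (1 / (4 * G * D)) \<alpha>"
  define g where "g = (\<lambda>\<tau>. gr \<tau> (x \<tau>))"
  define L where "L = ln (1 + \<beta> * G^2 * real T / (\<eta> 0 * real n))"
  define m where "m = Max (d ` {1..T})"
  define B2 where "B2 = G^2 * (\<Sum>t=1..T. real (card (miss d t)) / \<eta> (t - 1))"
  have \<beta>: "\<beta> > 0" "2 * \<beta> \<le> \<alpha>" using pos D(1) by (auto simp: \<beta>_def)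
  have "2 * \<beta> \<le> 1 / (4 * G * D)" by (simp add: \<beta>_def)
  then have small: "8 * \<beta> * G * D \<le> 1" using pos D(1) by (simp add: field_simps)
  have "(\<Sum>t=1..T. f t (x t) - f t u)
      \<le> 3 * (real n / \<beta> * L + \<eta> T * D^2 + min ((G^2 / \<eta> 0 + 1 / \<beta>) * real n * real m * L) B2)"
    if x1: "x 1 \<in> X"
      and step: "\<forall>t. 1 \<le> t \<and> t < T \<longrightarrow>
            x (t+1) \<in> X \<and> (\<forall>y\<in>X. ons_obj n \<beta> d g x (\<eta> t) t (x (t+1)) \<le> ons_obj n \<beta> d g x (\<eta> t) t y)"
      and u: "u \<in> X" for u
  proof -
    have xmin: "minimizer (reg_obj n \<beta> g x (obs d t) (\<eta> (t - 1))) X (x t)" if "1 < t" "t \<le> T" for t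
    proof -
      \<comment> \<open>The update rule is indexed by the round before the play, hence the weight
        \<open>\<eta> (t - 1)\<close> with the observations \<open>obs d t\<close>.\<close>
      have "1 \<le> t - 1 \<and> t - 1 < T" "t - 1 + 1 = t" using that by auto
      then show ?thesis using step[rule_format, of "t - 1"] by (simp add: minimizer_def ons_obj_eq)
    qed
    have xX: "x t \<in> X" if "t \<in> {1..T}" for t
      using that x1 xmin[of t] by (cases "t = 1") (auto simp: minimizer_def)
    have gG: "nrm n (g t) \<le> G" if "t \<in> {1..T}" for t
      using f xX that by (simp add: g_def)
    have "(\<Sum>t=1..T. f t (x t) - f t u)
        \<le> (\<Sum>t=1..T. surr n \<beta> (g t) (x t) (x t) - surr n \<beta> (g t) (x t) u)"
    proof (intro sum_mono exp_concave_surrogate)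
      fix t assume t: "t \<in> {1..T}"
      show "has_grad n (f t) (g t) (x t)" "concave_fn X (\<lambda>z. exp (- \<alpha> * f t z))"
        using f t xX by (auto simp: g_def)
      have "\<bar>ip n (g t) (vdiff u (x t))\<bar> \<le> G * D"
        using gG[OF t] D(2) u xX[OF t] by (intro abs_ip_le_bound) auto
      then show "\<bar>\<beta> * ip n (g t) (vdiff u (x t))\<bar> \<le> 1 / 8" by (rule scaled_le_eighth[OF \<beta>(1) small])
    qed (use X \<beta> u xX in auto)
    also have "\<dots> \<le> 3 * (n / \<beta> * L + \<eta> T * D\<^sup>2 + min (n / \<beta> * L * m) B2)"
      using D(2) \<eta>(2)
      by (intro surrogate_regret[OF n T X(1,3,4,5) D(1) _ pos(2) gG \<beta>(1) small \<eta>(1) _ _ x1 xmin u L_def B2_def])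
        (auto simp: m_def)
    also have "\<dots> \<le> 3 * (n / \<beta> * L + \<eta> T * D\<^sup>2
        + min ((G\<^sup>2 / \<eta> 0 + 1 / \<beta>) * real n * real m * L) B2)"
    proof -
      have "0 \<le> L" unfolding L_def using \<beta> \<eta>(1) by simp
      \<comment> \<open>This nonnegative term is the difference between B_1 and the delay bound just
        obtained.\<close>
      then have "0 \<le> G\<^sup>2 / \<eta> 0 * (real n * real m * L)" using \<eta>(1) by simp
      then have "n / \<beta> * L * m \<le> (G\<^sup>2 / \<eta> 0 + 1 / \<beta>) * real n * real m * L"
        by (simp add: algebra_simps)
      then show ?thesis by (intro mult_left_mono add_left_mono min.mono) auto
    qed
    finally show ?thesis .
  qed
  then show "(let \<beta> = 1/2 * min (1 / (4 * G * D)) \<alpha>;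
         g = (\<lambda>\<tau>. gr \<tau> (x \<tau>));
         L = ln (1 + \<beta> * G^2 * real T / (\<eta> 0 * real n));
         dmax = Max (d ` {1..T});
         B1 = (G^2 / \<eta> 0 + 1 / \<beta>) * real n * real dmax * L;
         B2 = G^2 * (\<Sum>t=1..T. real (card (miss d t)) / \<eta> (t - 1))
     in x 1 \<in> X \<longrightarrow>
        (\<forall>t. 1 \<le> t \<and> t < T \<longrightarrow>
            x (t+1) \<in> X \<and> (\<forall>y\<in>X. ons_obj n \<beta> d g x (\<eta> t) t (x (t+1)) \<le> ons_obj n \<beta> d g x (\<eta> t) t y)) \<longrightarrow>
        (\<forall>u\<in>X. (\<Sum>t=1..T. f t (x t) - f t u)
            \<le> 3 * (real n / \<beta> * L + \<eta> T * D^2 + min B1 B2)))"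
    unfolding Let_def \<beta>_def[symmetric] g_def[symmetric]
      L_def[symmetric] m_def[symmetric] B2_def[symmetric]
    by blast
qed

end
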